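(* Let $n\ge1$, let $f$ satisfy (F1)-(F4), let $\kappa>0$, and let $v\in C^2(\mathbb{R}^n)$, $0<v<1$, be a solution of $$-\Delta v+\kappa\,\partial_n v=f(v)\quad\text{in }\mathbb{R}^n$$ with $\sup_{\mathbb{R}^n}v=1$ and $$v(x)\to0\quad\text{uniformly as }\mathrm{dist}\big(x,\{v\ge1-b_0\}\big)\to+\infty.$$ Then for every $\lambda\in(0,1)$ there is a globally Lipschitz function $h_\lambda:\mathbb{R}^{n-1}\to\mathbb{R}$ such that $\{v=\lambda\}=\{(x',x_n):x_n=h_\lambda(x')\}$.
   Context: Hypotheses on $f:[0,1]\to\mathbb{R}$: (F1) $f$ is Lipschitz on $[0,1]$, $f(0)=f(1)=0$, and $f\in C^{1,\alpha}([0,\gamma)\cup(1-\gamma,1])$ for some $\alpha,\gamma\in(0,1)$; (F2) $f'(1)<0$; (F3) $\int_0^1 f(u)\,du>0$; (F4) there is $\theta\in(0,1)$ with $f>0$ in $(\theta,1)$ and either $f<0$ in $(0,\theta)$ with $f'(0)<0$ (bistable), or $f\equiv0$ in $(0,\theta)$ (combustion). Points of $\mathbb{R}^n$ are written $x=(x',x_n)$, $x'\in\mathbb{R}^{n-1}$; $\mathrm{dist}$ is Euclidean distance. The constant $b_0\in(0,1)$ is a fixed constant depending only on $n$ and $f$ such that every entire (smooth, defined on all of $\mathbb{R}^n\times\mathbb{R}$) solution $w$ of $\partial_t w-\Delta w=f(w)$, $0<w<1$, with $\sup_{x}w(x,t)=1$ for all $t$ satisfies: (a) for each $\lambda\in[1-b_0,1)$,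 $\{w=\lambda\}$ is the graph $\{t=h_\lambda(x)\}$ of a globally Lipschitz function on $\mathbb{R}^n$; (b) $\partial_t w\ge c_0(1-w)$ and $|\nabla w|+|\partial_t w|\le C_0(1-w)$ in $\{w>1-b_0\}$, with constants $c_0,C_0>0$ depending only on $n$ and $f$. (If $v$ is as in the claim, $w(x,t)=v(x+\kappa te_n)$ is such an entire solution.) *)

theory Defs
  imports "HOL-Analysis.Analysis"
begin

text \<open>The reaction term is a function on \<open>[0,1]\<close>; it is modelled as a total function of which only
  the values on \<open>[0,1]\<close> are constrained or used. Derivatives at the endpoints are one-sided.\<close>

definition C1_holder_on :: "real \<Rightarrow> real set \<Rightarrow> (real \<Rightarrow> real) \<Rightarrow> bool" where
  "C1_holder_on \<alpha> S f \<longleftrightarrow>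
     (\<exists>f' C. (\<forall>u\<in>S. (f has_real_derivative f' u) (at u within S)) \<and>
             (\<forall>u\<in>S. \<forall>v\<in>S. \<bar>f' u - f' v\<bar> \<le> C * \<bar>u - v\<bar> powr \<alpha>))"

definition F1 :: "(real \<Rightarrow> real) \<Rightarrow> bool" where
  "F1 f \<longleftrightarrow>
     (\<exists>L. L-lipschitz_on {0..1} f) \<and> f 0 = 0 \<and> f 1 = 0 \<and>
     (\<exists>\<alpha> \<gamma>. 0 < \<alpha> \<and> \<alpha> < 1 \<and> 0 < \<gamma> \<and> \<gamma> < 1 \<and>
        C1_holder_on \<alpha> ({0..1} \<inter> ({0..<\<gamma>} \<union> {1-\<gamma><..1})) f)"

definition F2 :: "(real \<Rightarrow> real) \<Rightarrow> bool" where
  "F2 f \<longleftrightarrow> (\<exists>d<0. (f has_real_derivative d) (at 1 within {0..1}))"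

definition F3 :: "(real \<Rightarrow> real) \<Rightarrow> bool" where
  "F3 f \<longleftrightarrow> integral {0..1} f > 0"

definition F4 :: "(real \<Rightarrow> real) \<Rightarrow> bool" where
  "F4 f \<longleftrightarrow>
     (\<exists>\<theta>. 0 < \<theta> \<and> \<theta> < 1 \<and> (\<forall>u\<in>{\<theta><..<1}. f u > 0) \<and>
        ((\<forall>u\<in>{0<..<\<theta>}. f u < 0) \<and>
           (\<exists>d<0. (f has_real_derivative d) (at 0 within {0..1}))
         \<or> (\<forall>u\<in>{0<..<\<theta>}. f u = 0)))"

definition partial :: "'n::finite \<Rightarrow> (real^'n \<Rightarrow> real) \<Rightarrow> real^'n \<Rightarrow> real" where
  "partial i u x = frechet_derivative u (at x) (axis i 1)"

definition grad :: "(real^'n::finite \<Rightarrow> real) \<Rightarrow> real^'n \<Rightarrow> real^'n" where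
  "grad u x = (\<chi> i. partial i u x)"

definition laplacian :: "(real^'n::finite \<Rightarrow> real) \<Rightarrow> real^'n \<Rightarrow> real" where
  "laplacian u x = (\<Sum>i\<in>UNIV. partial i (partial i u) x)"

definition C2 :: "(real^'n::finite \<Rightarrow> real) \<Rightarrow> bool" where
  "C2 u \<longleftrightarrow>
     (\<forall>x. u differentiable (at x)) \<and>
     (\<forall>i x. partial i u differentiable (at x)) \<and>
     (\<forall>i j. continuous_on UNIV (partial j (partial i u)))"

definition dt :: "(real^'n::finite \<Rightarrow> real \<Rightarrow> real) \<Rightarrow> real^'n \<Rightarrow> real \<Rightarrow> real" where
  "dt w x t = deriv (w x) t"

text \<open>The class \<open>C\<^sup>2\<^sup>,\<^sup>1\<close> of functions \<open>w(x,t)\<close>: twice continuously differentiable in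
  space and once in time, with all these derivatives jointly continuous on space-time. This is the
  natural class of smooth (classical) solutions of the reaction-diffusion equation, as \<open>f\<close> is merely
  Lipschitz and solutions need not be infinitely differentiable.\<close>

definition C21 :: "(real^'n::finite \<Rightarrow> real \<Rightarrow> real) \<Rightarrow> bool" where
  "C21 w \<longleftrightarrow>
     (\<forall>t. C2 (\<lambda>x. w x t)) \<and>
     (\<forall>x t. w x differentiable (at t)) \<and>
     continuous_on UNIV (\<lambda>(x, t). w x t) \<and>
     continuous_on UNIV (\<lambda>(x, t). dt w x t) \<and>
     (\<forall>i. continuous_on UNIV (\<lambda>(x, t). partial i (\<lambda>y. w y t) x)) \<and>
     (\<forall>i j. continuous_on UNIV (\<lambda>(x, t). partial j (partial i (\<lambda>y. w y t)) x))"

definition entire_solution :: "(real \<Rightarrow> real) \<Rightarrow> (real^'n::finite \<Rightarrow> real \<Rightarrow> real) \<Rightarrow> bool" where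
  "entire_solution f w \<longleftrightarrow>
     C21 w \<and>
     (\<forall>x t. 0 < w x t \<and> w x t < 1) \<and>
     (\<forall>x t. dt w x t - laplacian (\<lambda>y. w y t) x = f (w x t)) \<and>
     (\<forall>t. (SUP x. w x t) = 1)"

text \<open>The defining property of the constant \<open>b\<^sub>0\<close>. The dimension enters through the index type;
  \<open>c\<^sub>0\<close> and \<open>C\<^sub>0\<close> are chosen before the solution \<open>w\<close>, i.e. depend on \<open>n\<close> and \<open>f\<close> (and \<open>b\<^sub>0\<close>) only.
  The gradient is the spatial one.\<close>

definition is_b0 :: "'n::finite itself \<Rightarrow> (real \<Rightarrow> real) \<Rightarrow> real \<Rightarrow> bool" where
  "is_b0 (TYPE('n)) f b0 \<longleftrightarrow>
     0 < b0 \<and> b0 < 1 \<and>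
     (\<exists>c0>0. \<exists>C0>0. \<forall>w :: real^'n \<Rightarrow> real \<Rightarrow> real. entire_solution f w \<longrightarrow>
        (\<forall>l\<in>{1-b0..<1}. \<exists>h L. L-lipschitz_on UNIV h \<and>
            {(x, t). w x t = l} = {(x, t). t = h x}) \<and>
        (\<forall>x t. w x t > 1 - b0 \<longrightarrow>
            dt w x t \<ge> c0 * (1 - w x t) \<and>
            norm (grad (\<lambda>y. w y t) x) + \<bar>dt w x t\<bar> \<le> C0 * (1 - w x t)))"

text \<open>Writing \<open>x = (x', x\<^sub>n)\<close>: the distinguished coordinate \<open>x\<^sub>n\<close> is \<open>x $ k\<close> for a fixed index \<open>k\<close>,
  and \<open>\<real>\<^sup>n\<^sup>-\<^sup>1\<close> is identified isometrically with the hyperplane \<open>{y. y $ k = 0}\<close>, so that the case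
  \<open>n = 1\<close> (where \<open>\<real>\<^sup>0\<close> is a point) is included. The map below is \<open>x \<mapsto> x'\<close>.\<close>

definition hyperplane :: "'n::finite \<Rightarrow> (real^'n) set" where
  "hyperplane k = {y. y $ k = 0}"

definition horiz :: "'n::finite \<Rightarrow> real^'n \<Rightarrow> real^'n" where
  "horiz k x = (\<chi> i. if i = k then 0 else x $ i)"

text \<open>\<open>u(x) \<rightarrow> 0\<close> uniformly as the distance from \<open>x\<close> to \<open>S\<close> tends to infinity. Only meaningful for
  nonempty \<open>S\<close>, since \<open>infdist x {} = 0\<close>.\<close>

definition vanishes_away_from :: "(real^'n::finite) set \<Rightarrow> (real^'n \<Rightarrow> real) \<Rightarrow> bool" where
  "vanishes_away_from S u \<longleftrightarrow>
     (\<forall>\<epsilon>>0. \<exists>R. \<forall>x. infdist x S \<ge> R \<longrightarrow> \<bar>u x\<bar> < \<epsilon>)"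

end

theory Submission imports Defs begin

text \<open>
  The wave, seen in a moving frame, is an entire solution, so the properties of \<open>b\<^sub>0\<close> describe
  \<open>v\<close> in \<open>{v > 1 - b\<^sub>0}\<close>: there \<open>\<partial>\<^sub>n v\<close> is bounded below by a multiple of \<open>1 - v\<close>, and \<open>\<bar>\<nabla>v\<bar>\<close>
  above by another one. Their quotient gives a cone of directions around \<open>e\<^sub>n\<close> along which \<open>v\<close>
  increases, at a quantified rate, as long as \<open>v > 1 - b\<^sub>0\<close>. The theorem follows once \<open>v\<close> is shown to
  be strictly increasing along a smaller cone in all of \<open>\<real>\<^sup>n\<close> (\<open>cone_strictly_monotone\<close>): the opening
  of the cone then bounds the Lipschitz constant of every level set.

  To prove this, fix a displacement \<open>h\<close> in the smaller cone and slide \<open>v(\<cdot> + \<tau>h)\<close> from \<open>\<tau> = \<infinity>\<close>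
  down to \<open>\<tau> = 0\<close>, keeping it above \<open>v\<close>. For large \<open>\<tau>\<close> every point with \<open>v \<ge> \<delta>\<close> is moved deep into
  \<open>{v > 1 - b\<^sub>0}\<close>, because such points stay within a bounded distance of that region
  (\<open>uniform_lift\<close>). In \<open>{v < \<delta>}\<close> the reaction term is nonincreasing, so the order propagates there
  from \<open>{v \<ge> \<delta>}\<close> (\<open>comparison_below\<close>). If the sliding stopped at some \<open>\<tau> > 0\<close>, then
  \<open>z = v(\<cdot> + \<tau>h) - v \<ge> 0\<close> would be bounded away from zero on \<open>{\<delta> \<le> v \<le> 1 - b\<^sub>0}\<close>
  (\<open>uniform_positivity\<close>), and a smaller \<open>\<tau>\<close> would still do because \<open>v\<close> is Lipschitz.

  The domain is unbounded and \<open>z\<close> need not attain its infimum. Instead of extracting limits of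
  translates, every use of the strong maximum principle is made quantitative by one explicit barrier
  (\<open>barrier_constant_exists\<close>): a nonnegative supersolution that is at least \<open>\<eta>\<close> on a ball of radius
  \<open>r\<close> is at least \<open>a \<eta>\<close> on the concentric ball of radius \<open>R\<close>, with \<open>a\<close> depending on neither the
  function nor the centre. Every point with \<open>v\<close> between a positive bound and \<open>1 - b\<^sub>0/2\<close> has, within
  bounded distance, a point where \<open>v = 1 - b\<^sub>0/2\<close>; around such a point the estimates in
  \<open>{v > 1 - b\<^sub>0}\<close> provide a ball of fixed radius on which the increments of \<open>v\<close> are controlled, and
  the barrier carries this control back.
\<close>

section \<open>Derivatives along coordinate lines\<close>

lemma second_derivative_nonneg_at_local_min:
  fixes g g' :: "real \<Rightarrow> real"
  assumes g: "\<And>t. (g has_real_derivative g' t) (at t)"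
    and g': "(g' has_real_derivative D) (at 0)"
    and d: "d > 0" and min: "\<And>t. \<bar>t\<bar> < d \<Longrightarrow> g 0 \<le> g t"
  shows "g' 0 = 0" and "0 \<le> D"
proof -
  show z: "g' 0 = 0"
    by (rule DERIV_local_min[OF g d]) (use min in auto)
  show "0 \<le> D"
  proof (rule ccontr)
    assume "\<not> 0 \<le> D"
    then obtain e where e: "e > 0" "\<And>h. h > 0 \<Longrightarrow> h < e \<Longrightarrow> g' (0 + h) < g' 0"
      using DERIV_neg_dec_right[OF g'] by (metis not_le)
    define s where "s = min d e / 2"
    have s: "0 < s" "s < d" "s < e" using d e(1) by (auto simp: s_def)
    obtain y where y: "0 < y" "y < s" "g s - g 0 = (s - 0) * g' y"
      using MVT2[of 0 s g g'] s(1) g by blast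
    have "g' y < 0" using e(2)[of y] y s z by auto
    then have "g s < g 0" using y s(1) mult_pos_neg[of s "g' y"] by auto
    with min[of s] s show False by auto
  qed
qed

text \<open>Minimum tests below only look along coordinate lines. This weak form of twice
  differentiability passes to translates, differences and added constants without any chain rule
  for Frechet derivatives.\<close>

definition line_derivs ::
    "(real^'n::finite \<Rightarrow> real) \<Rightarrow> ('n \<Rightarrow> real^'n \<Rightarrow> real) \<Rightarrow> ('n \<Rightarrow> real^'n \<Rightarrow> real) \<Rightarrow> bool" where
  "line_derivs u u1 u2 \<longleftrightarrow> continuous_on UNIV u \<and>
     (\<forall>i x t. ((\<lambda>s. u (x + s *\<^sub>R axis i 1)) has_real_derivative u1 i (x + t *\<^sub>R axis i 1)) (at t)) \<and>
     (\<forall>i x t. ((\<lambda>s. u1 i (x + s *\<^sub>R axis i 1)) has_real_derivative u2 i (x + t *\<^sub>R axis i 1)) (at t))"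

lemma frechet_derivative_eq_grad:
  fixes u :: "real^'n \<Rightarrow> real"
  assumes "u differentiable (at x)"
  shows "frechet_derivative u (at x) h = grad u x \<bullet> h"
proof -
  have lin: "linear (frechet_derivative u (at x))"
    using assms linear_frechet_derivative by blast
  have "h = (\<Sum>i\<in>UNIV. h $ i *\<^sub>R axis i 1)"
    using basis_expansion[of h] by (simp add: scalar_mult_eq_scaleR)
  then have "frechet_derivative u (at x) h = (\<Sum>i\<in>UNIV. h $ i * partial i u x)"
    using linear_sum[OF lin, of "\<lambda>i. h $ i *\<^sub>R axis i 1" UNIV]
    by (simp add: linear_cmul[OF lin] partial_def)
  then show ?thesis by (simp add: inner_vec_def grad_def mult.commute)
qed

lemma derivative_along_line:
  fixes u :: "real^'n \<Rightarrow> real"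
  assumes "\<And>y. u differentiable (at y)"
  shows "((\<lambda>s. u (x + s *\<^sub>R h)) has_real_derivative grad u (x + t *\<^sub>R h) \<bullet> h) (at t)"
proof -
  let ?D = "frechet_derivative u (at (x + t *\<^sub>R h))"
  have D: "(u has_derivative ?D) (at (x + t *\<^sub>R h))"
    using assms frechet_derivative_works by blast
  have lin: "linear ?D" using assms linear_frechet_derivative by blast
  have "((\<lambda>s. x + s *\<^sub>R h) has_derivative (\<lambda>s. s *\<^sub>R h)) (at t)"
    by (auto intro!: derivative_eq_intros)
  from has_derivative_compose[OF this D]
  have "((\<lambda>s. u (x + s *\<^sub>R h)) has_derivative (\<lambda>s. ?D (s *\<^sub>R h))) (at t)" .
  moreover have "(\<lambda>s. ?D (s *\<^sub>R h)) = (*) (grad u (x + t *\<^sub>R h) \<bullet> h)"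
    using assms by (auto simp: linear_cmul[OF lin] frechet_derivative_eq_grad)
  ultimately show ?thesis by (simp add: has_field_derivative_def)
qed

lemma inner_grad_axis: "grad u x \<bullet> axis i 1 = partial i u x"
  by (simp add: inner_axis grad_def)

lemma line_derivs_C2:
  assumes "C2 u"
  shows "line_derivs u (\<lambda>i. partial i u) (\<lambda>i. partial i (partial i u))"
  unfolding line_derivs_def
proof (intro conjI allI)
  have d: "\<And>x. u differentiable (at x)" "\<And>i x. partial i u differentiable (at x)"
    using assms by (auto simp: C2_def)
  show "continuous_on UNIV u"
    using d(1) by (simp add: continuous_at_imp_continuous_on differentiable_imp_continuous_within)
  show "((\<lambda>s. u (x + s *\<^sub>R axis i 1)) has_real_derivative partial i u (x + t *\<^sub>R axis i 1)) (at t)" for i x t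
    using derivative_along_line[OF d(1), of x "axis i 1" t] by (simp add: inner_grad_axis)
  show "((\<lambda>s. partial i u (x + s *\<^sub>R axis i 1)) has_real_derivative
      partial i (partial i u) (x + t *\<^sub>R axis i 1)) (at t)" for i x t
    using derivative_along_line[OF d(2), of i x "axis i 1" t] by (simp add: inner_grad_axis)
qed

lemma line_derivs_increment:
  assumes "line_derivs u u1 u2"
  shows "line_derivs (\<lambda>x. u (x + h) - u x + m) (\<lambda>i x. u1 i (x + h) - u1 i x) (\<lambda>i x. u2 i (x + h) - u2 i x)"
proof -
  have c: "continuous_on UNIV u"
    and d1: "\<And>i x t. ((\<lambda>s. u (x + s *\<^sub>R axis i 1)) has_real_derivative u1 i (x + t *\<^sub>R axis i 1)) (at t)"
    and d2: "\<And>i x t. ((\<lambda>s. u1 i (x + s *\<^sub>R axis i 1)) has_real_derivative u2 i (x + t *\<^sub>R axis i 1)) (at t)"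
    using assms by (auto simp: line_derivs_def)
  have "continuous_on UNIV (\<lambda>x. u (x + h))"
    by (rule continuous_on_compose2[OF c]) (auto intro: continuous_intros)
  with c have 1: "continuous_on UNIV (\<lambda>x. u (x + h) - u x + m)"
    by (intro continuous_intros)
  have sh: "x + s *\<^sub>R axis i 1 + h = (x + h) + s *\<^sub>R axis i 1" for x :: "real^'a" and s i
    by (simp add: algebra_simps)
  show ?thesis
    unfolding line_derivs_def using 1
    by (auto intro!: derivative_eq_intros d1 d2 simp: sh)
qed


section \<open>A quantitative strong maximum principle\<close>

text \<open>The number \<open>a\<close> carries a lower bound for nonnegative supersolutions from a ball of radius \<open>r\<close>
  to one of radius \<open>R\<close>. The differential inequality is only demanded where \<open>Z < \<eta>\<close>. This covers
  truncations: if \<open>z \<ge> - m\<close> is a supersolution where it is negative, then \<open>Z = z + m\<close> qualifies with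
  \<open>\<eta> = m\<close>, although \<open>min z 0 + m\<close> is not differentiable.\<close>

definition barrier_constant ::
    "real \<Rightarrow> 'n::finite \<Rightarrow> real \<Rightarrow> real \<Rightarrow> real \<Rightarrow> real \<Rightarrow> bool" where
  "barrier_constant \<kappa> k L r R a \<longleftrightarrow>
     (\<forall>(Z :: real^'n \<Rightarrow> real) Z1 Z2 p \<eta> x.
        line_derivs Z Z1 Z2 \<longrightarrow> (\<forall>x. 0 \<le> Z x) \<longrightarrow> 0 < \<eta> \<longrightarrow>
        (\<forall>x. Z x < \<eta> \<longrightarrow> 0 \<le> - (\<Sum>i\<in>UNIV. Z2 i x) + \<kappa> * Z1 k x + L * Z x) \<longrightarrow>
        (\<forall>x. dist x p \<le> r \<longrightarrow> \<eta> \<le> Z x) \<longrightarrow> dist x p \<le> R \<longrightarrow> a * \<eta> \<le> Z x)"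

text \<open>The comparison function \<open>\<phi>(x) = \<eta> (exp(- A\<bar>x - p\<bar>\<^sup>2) - exp(- A(R + 1)\<^sup>2))\<close> is, for large \<open>A\<close>, a
  strict subsolution outside the ball of radius \<open>r\<close>. It is at most \<open>\<eta>\<close> in that ball and vanishes at
  distance \<open>R + 1\<close>, so \<open>Z - \<phi>\<close> could only be negative somewhere if it had a negative minimum strictly
  between the two spheres, which the inequalities exclude. The radius \<open>R + 1\<close> rather than \<open>R\<close> keeps
  \<open>\<phi>\<close> bounded away from zero up to distance \<open>R\<close>.\<close>

lemma barrier_constant_exists:
  fixes k :: "'n::finite"
  assumes "0 \<le> \<kappa>" "0 \<le> L" "0 < r" "r \<le> R"
  obtains a where "0 < a" "barrier_constant \<kappa> k L r R a"
proof -
  define n where "n = real CARD('n)"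
  \<comment> \<open>chosen such that the term \<open>4 A\<^sup>2 r\<^sup>2\<close> in the Laplacian of the exponential beats
     \<open>2 n A + 2 A \<kappa> (R + 1) + L\<close>; the summand 1 makes \<open>L \<le> A L\<close>\<close>
  define A where "A = 1 + (2 * n + 2 * \<kappa> * (R + 1) + L) / (4 * r\<^sup>2)"
  define E where "E = exp (- A * (R + 1)\<^sup>2)"
  define c where "c = exp (- A * R\<^sup>2) - E"
  have n: "0 \<le> n" and R: "0 < R" using assms by (auto simp: n_def)
  have "0 \<le> (2 * n + 2 * \<kappa> * (R + 1) + L) / (4 * r\<^sup>2)"
    using assms n R by (intro divide_nonneg_nonneg add_nonneg_nonneg mult_nonneg_nonneg) auto
  then have A1: "1 \<le> A" by (simp add: A_def)
  have "(A - 1) * (4 * r\<^sup>2) = 2 * n + 2 * \<kappa> * (R + 1) + L"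
    using assms(3) by (simp add: A_def)
  moreover have "(A - 1) * (4 * r\<^sup>2) < A * (4 * r\<^sup>2)"
    using assms(3) by simp
  ultimately have A2: "2 * n + 2 * \<kappa> * (R + 1) + L < 4 * A * r\<^sup>2" by simp
  have "R\<^sup>2 < (R + 1)\<^sup>2" using R by (simp add: power_strict_mono)
  then have "0 < c" using A1 by (simp add: c_def E_def)
  moreover have "c * \<eta> \<le> Z x"
    if ld: "line_derivs Z Z1 Z2" and Z0: "\<And>x::real^'n. 0 \<le> Z x" and \<eta>: "0 < \<eta>"
      and super: "\<And>x. Z x < \<eta> \<Longrightarrow> 0 \<le> - (\<Sum>i\<in>UNIV. Z2 i x) + \<kappa> * Z1 k x + L * Z x"
      and inner: "\<And>x. dist x p \<le> r \<Longrightarrow> \<eta> \<le> Z x" and x: "dist x p \<le> R"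
    for Z :: "real^'n \<Rightarrow> real" and Z1 Z2 p \<eta> x
  proof -
    define \<phi> where "\<phi> y = \<eta> * (exp (- A * (dist y p)\<^sup>2) - E)" for y
    define G where "G y = Z y - \<phi> y" for y
    have Zc: "continuous_on UNIV Z"
      and d1: "\<And>i x t. ((\<lambda>s. Z (x + s *\<^sub>R axis i 1)) has_real_derivative Z1 i (x + t *\<^sub>R axis i 1)) (at t)"
      and d2: "\<And>i x t. ((\<lambda>s. Z1 i (x + s *\<^sub>R axis i 1)) has_real_derivative Z2 i (x + t *\<^sub>R axis i 1)) (at t)"
      using ld by (auto simp: line_derivs_def)
    have Gc: "continuous_on UNIV G"
      unfolding G_def \<phi>_def by (intro continuous_intros Zc)
    obtain q where q: "q \<in> cball p (R + 1)" "\<And>y. y \<in> cball p (R + 1) \<Longrightarrow> G q \<le> G y"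
      using continuous_attains_inf[OF compact_cball _ continuous_on_subset[OF Gc subset_UNIV]] R
      by (metis cball_eq_empty add_pos_pos not_less_iff_gr_or_eq zero_less_one)
    have "0 \<le> G q"
    proof (rule ccontr)
      assume "\<not> 0 \<le> G q"
      then have neg: "Z q < \<phi> q" by (simp add: G_def)
      have E0: "0 < E" by (simp add: E_def)
      define e where "e = exp (- A * (dist q p)\<^sup>2)"
      have e0: "0 < e" by (simp add: e_def)
      have e1: "e \<le> 1" using A1 by (simp add: e_def)
      have Zq: "Z q < \<eta> * e"
      proof -
        have "\<phi> q < \<eta> * e" using \<eta> E0 by (simp add: \<phi>_def e_def algebra_simps)
        then show ?thesis using neg by simp
      qed
      have Zq': "Z q < \<eta>"
        using Zq mult_left_mono[OF e1, of \<eta>] \<eta> by linarith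
      have qr: "r < dist q p" using inner[of q] Zq' by fastforce
      have qR: "dist q p < R + 1"
      proof (rule ccontr)
        assume "\<not> dist q p < R + 1"
        then have "dist q p = R + 1" using q(1) by (simp add: dist_commute)
        then have "\<phi> q = 0" by (simp add: \<phi>_def E_def)
        then show False using neg Z0[of q] by simp
      qed
      define y where "y i = (q - p) $ i" for i
      have dexp: "(dist (q + t *\<^sub>R axis i 1) p)\<^sup>2 = (dist q p)\<^sup>2 + 2 * t * y i + t\<^sup>2" for t i
      proof -
        have "(dist (q + t *\<^sub>R axis i 1) p)\<^sup>2 = (norm ((q - p) + t *\<^sub>R axis i 1))\<^sup>2"
          by (simp add: dist_norm algebra_simps)
        also have "\<dots> = (q - p) \<bullet> (q - p) + 2 * t * ((q - p) \<bullet> axis i 1) + t\<^sup>2"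
          unfolding power2_norm_eq_inner
          by (simp add: inner_add_left inner_add_right inner_commute inner_axis_axis power2_eq_square
              del: inner_diff_left inner_diff_right)
        finally show ?thesis
          by (simp add: dist_norm power2_norm_eq_inner y_def inner_axis)
      qed
      \<comment> \<open>first and second derivative test for \<open>Z - \<phi>\<close> along the \<open>i\<close>-th coordinate line\<close>
      have key: "Z1 i q = - 2 * A * \<eta> * e * y i \<and> \<eta> * e * (4 * A\<^sup>2 * (y i)\<^sup>2 - 2 * A) \<le> Z2 i q" for i
      proof -
        define E' where "E' t = exp (- A * ((dist q p)\<^sup>2 + 2 * t * y i + t\<^sup>2))" for t
        have E': "(E' has_real_derivative E' t * (- A * (2 * y i + 2 * t))) (at t)" for t
          unfolding E'_def by (auto intro!: derivative_eq_intros simp: algebra_simps)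
        have E'0: "E' 0 = e" by (simp add: E'_def e_def)
        define g where "g t = Z (q + t *\<^sub>R axis i 1) - \<eta> * (E' t - E)" for t
        define g' where "g' t = Z1 i (q + t *\<^sub>R axis i 1) - \<eta> * (E' t * (- A * (2 * y i + 2 * t)))" for t
        have gG: "g t = G (q + t *\<^sub>R axis i 1)" for t
          by (simp add: g_def G_def \<phi>_def E'_def dexp)
        have dg: "(g has_real_derivative g' t) (at t)" for t
          unfolding g_def g'_def by (auto intro!: derivative_eq_intros d1 E')
        have dg': "(g' has_real_derivative
            Z2 i q - \<eta> * e * (4 * A\<^sup>2 * (y i)\<^sup>2 - 2 * A)) (at 0)"
        proof -
          have "(g' has_real_derivative Z2 i (q + 0 *\<^sub>R axis i 1) -
             \<eta> * (E' 0 * (- A * (2 * y i + 2 * 0)) * (- A * (2 * y i + 2 * 0)) + E' 0 * (- A * 2))) (at 0)"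
            unfolding g'_def
            by (auto intro!: derivative_eq_intros E' DERIV_cong[OF d2] simp: algebra_simps simp del: scale_zero_left) 
          moreover have "Z2 i (q + 0 *\<^sub>R axis i 1) -
             \<eta> * (E' 0 * (- A * (2 * y i + 2 * 0)) * (- A * (2 * y i + 2 * 0)) + E' 0 * (- A * 2))
             = Z2 i q - \<eta> * e * (4 * A\<^sup>2 * (y i)\<^sup>2 - 2 * A)"
            unfolding E'0 by (simp add: power2_eq_square) algebra
          ultimately show ?thesis by (rule DERIV_cong)
        qed
        have loc: "g 0 \<le> g t" if "\<bar>t\<bar> < R + 1 - dist q p" for t
        proof -
          have "dist (q + t *\<^sub>R axis i 1) p \<le> dist (q + t *\<^sub>R axis i 1) q + dist q p"
            by (rule dist_triangle)
          also have "dist (q + t *\<^sub>R axis i 1) q = \<bar>t\<bar>" by (simp add: dist_norm)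
          finally have "q + t *\<^sub>R axis i 1 \<in> cball p (R + 1)"
            using that by (simp add: dist_commute)
          from q(2)[OF this] show ?thesis by (simp add: gG)
        qed
        from second_derivative_nonneg_at_local_min[where d = "R + 1 - dist q p", OF dg dg' _ loc] qR
        have "g' 0 = 0" "0 \<le> Z2 i q - \<eta> * e * (4 * A\<^sup>2 * (y i)\<^sup>2 - 2 * A)" by auto
        then show ?thesis by (simp add: g'_def E'0 algebra_simps)
      qed
      have sumy: "(\<Sum>i\<in>UNIV. (y i)\<^sup>2) = (dist q p)\<^sup>2"
        unfolding dist_norm power2_norm_eq_inner by (simp add: inner_vec_def y_def power2_eq_square)
      have "(\<Sum>i\<in>UNIV. \<eta> * e * (4 * A\<^sup>2 * (y i)\<^sup>2 - 2 * A)) \<le> (\<Sum>i\<in>UNIV. Z2 i q)"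
        using key by (intro sum_mono) auto
      moreover have "(\<Sum>i\<in>UNIV. \<eta> * e * (4 * A\<^sup>2 * (y i)\<^sup>2 - 2 * A)) = \<eta> * e * (4 * A\<^sup>2 * (dist q p)\<^sup>2 - 2 * n * A)"
        by (simp add: sum_distrib_left[symmetric] sum_subtractf sumy n_def)
      moreover have "0 \<le> - (\<Sum>i\<in>UNIV. Z2 i q) + \<kappa> * Z1 k q + L * Z q"
        using super Zq' by blast
      moreover have "L * Z q \<le> L * (\<eta> * e)" using Zq assms(2) by (intro mult_left_mono) auto
      ultimately have "0 \<le> - (\<eta> * e * (4 * A\<^sup>2 * (dist q p)\<^sup>2 - 2 * n * A)) + \<kappa> * (- 2 * A * \<eta> * e * y k) + L * (\<eta> * e)"
        using key[of k] by simp
      also have "\<dots> = \<eta> * e * (- (4 * A\<^sup>2 * (dist q p)\<^sup>2 - 2 * n * A) - 2 * A * \<kappa> * y k + L)"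
        by (simp add: algebra_simps)
      finally have "0 \<le> - (4 * A\<^sup>2 * (dist q p)\<^sup>2 - 2 * n * A) - 2 * A * \<kappa> * y k + L"
        using mult_pos_pos[OF \<eta> e0] by (simp only: zero_le_mult_iff[of "\<eta> * e"]) linarith
      moreover have "- y k \<le> R + 1"
        using component_le_norm_cart[of "q - p" k] qR by (simp add: y_def dist_norm)
      then have "2 * A * \<kappa> * (- y k) \<le> 2 * A * \<kappa> * (R + 1)"
        using A1 assms(1) by (intro mult_left_mono) auto
      moreover have "L \<le> A * L" using A1 assms(2) by (simp add: mult_le_cancel_right1)
      moreover have "4 * A\<^sup>2 * r\<^sup>2 \<le> 4 * A\<^sup>2 * (dist q p)\<^sup>2"
        using qr assms(3) by (intro mult_left_mono power_mono) auto
      ultimately have "A * (4 * A * r\<^sup>2) \<le> A * (2 * n + 2 * \<kappa> * (R + 1) + L)"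
        by (simp add: algebra_simps power2_eq_square)
      then show False using A2 A1 by simp
    qed
    moreover have "x \<in> cball p (R + 1)" using x by (simp add: dist_commute)
    ultimately have "\<phi> x \<le> Z x" using q(2) by (fastforce simp: G_def)
    moreover have "c * \<eta> \<le> \<phi> x"
    proof -
      have "(dist x p)\<^sup>2 \<le> R\<^sup>2" using x by (intro power_mono) auto
      then have "exp (- A * R\<^sup>2) \<le> exp (- A * (dist x p)\<^sup>2)" using A1 by simp
      then show ?thesis using \<eta> by (simp add: \<phi>_def c_def mult.commute)
    qed
    ultimately show ?thesis by simp
  qed
  ultimately show thesis using that[of c] unfolding barrier_constant_def by blast
qed

lemma barrier_constantD:
  assumes "barrier_constant \<kappa> k L r R a" "line_derivs Z Z1 Z2" "\<And>x. 0 \<le> Z x" "0 < \<eta>"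
    and "\<And>x. Z x < \<eta> \<Longrightarrow> 0 \<le> - (\<Sum>i\<in>UNIV. Z2 i x) + \<kappa> * Z1 k x + L * Z x"
    and "\<And>x. dist x p \<le> r \<Longrightarrow> \<eta> \<le> Z x" "dist x p \<le> R"
  shows "a * \<eta> \<le> Z x"
  using assms unfolding barrier_constant_def by blast

section \<open>Bounded solutions are Lipschitz\<close>

lemma lipschitz_from_axis_steps:
  fixes u :: "real^'n \<Rightarrow> real"
  assumes "0 \<le> K" and step: "\<And>x i s. \<bar>u (x + s *\<^sub>R axis i 1) - u x\<bar> \<le> K * \<bar>s\<bar>"
  shows "\<bar>u (x + h) - u x\<bar> \<le> K * real CARD('n) * norm h"
proof -
  have "\<bar>u (x + (\<Sum>i\<in>A. h $ i *\<^sub>R axis i 1)) - u x\<bar> \<le> (\<Sum>i\<in>A. K * \<bar>h $ i\<bar>)" if "finite A" for A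
    using that
  proof (induction A rule: finite_induct)
    case (insert j A)
    let ?y = "x + (\<Sum>i\<in>A. h $ i *\<^sub>R axis i 1)"
    have "x + (\<Sum>i\<in>insert j A. h $ i *\<^sub>R axis i 1) = ?y + h $ j *\<^sub>R axis j 1"
      using insert by (simp add: algebra_simps)
    then show ?case using step[of ?y "h $ j" j] insert by (simp add: algebra_simps)
  qed simp
  from this[of UNIV] have "\<bar>u (x + h) - u x\<bar> \<le> (\<Sum>i\<in>UNIV. K * \<bar>h $ i\<bar>)"
    using basis_expansion[of h] by (simp add: scalar_mult_eq_scaleR)
  also have "\<dots> \<le> (\<Sum>i\<in>(UNIV::'n set). K * norm h)"
    using assms(1) component_le_norm_cart by (intro sum_mono mult_left_mono) auto
  finally show ?thesis by (simp add: mult_ac)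
qed

text \<open>Doubling of variables in the direction \<open>e\<^sub>i\<close>. The function
  \<open>d(x, s) = u(x + \<sigma>s e\<^sub>i) - u(x - \<sigma>s e\<^sub>i)\<close> vanishes at \<open>s = 0\<close> and satisfies
  \<open>\<Sum>\<^sub>j\<^sub>\<noteq>\<^sub>i \<partial>\<^sub>j\<^sub>j d + \<partial>\<^sub>s\<^sub>s d = \<Delta>u(x + \<sigma>s e\<^sub>i) - \<Delta>u(x - \<sigma>s e\<^sub>i)\<close>: the second derivative in \<open>s\<close> replaces
  the one in \<open>x\<^sub>i\<close>. On \<open>\<bar>x - p\<bar> \<le> 1\<close>, \<open>0 \<le> s \<le> 1\<close> it is therefore dominated by a multiple of the
  barrier \<open>\<bar>x - p\<bar>\<^sup>2 + M s (2 - s)\<close>, which at \<open>x = p\<close> is at most \<open>2 M s\<close>. A reflection of \<open>u\<close> would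
  reverse the drift when \<open>i = k\<close>; here both copies of \<open>u\<close> solve the same equation.\<close>

lemma bounded_solution_increment_bound:
  fixes u :: "real^'n \<Rightarrow> real" and k :: 'n
  assumes ld: "line_derivs u u1 u2" and \<kappa>: "0 \<le> \<kappa>"
    and range: "\<And>x. 0 < u x \<and> u x < 1"
    and pde: "\<And>x. \<bar>- (\<Sum>i\<in>UNIV. u2 i x) + \<kappa> * u1 k x\<bar> \<le> F"
    and \<sigma>: "\<sigma> = 1 \<or> \<sigma> = -1" and s: "0 \<le> s" "s \<le> 1"
  shows "u (p + (\<sigma> * s) *\<^sub>R axis i 1) - u (p - (\<sigma> * s) *\<^sub>R axis i 1)
           \<le> 2 * (F + 1) * (real CARD('n) + \<kappa> + 1) * s"
proof -
  \<comment> \<open>the \<open>n - 1\<close> directions of \<open>\<bar>x - p\<bar>\<^sup>2\<close> and the drift are absorbed by \<open>M\<close>, the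
     right-hand side by \<open>C\<close>; \<open>C, M \<ge> 1\<close> makes the barrier bound the increment on the rest of the boundary\<close>
  define M where "M = real CARD('n) + \<kappa> + 1"
  define C where "C = F + 1"
  define e :: "'n \<Rightarrow> real^'n" where "e j = axis j 1" for j
  have uc: "continuous_on UNIV u"
    and d1: "\<And>j x t. ((\<lambda>s. u (x + s *\<^sub>R e j)) has_real_derivative u1 j (x + t *\<^sub>R e j)) (at t)"
    and d2: "\<And>j x t. ((\<lambda>s. u1 j (x + s *\<^sub>R e j)) has_real_derivative u2 j (x + t *\<^sub>R e j)) (at t)"
    using ld by (auto simp: line_derivs_def e_def)
  have C: "1 \<le> C" using pde[of p] by (simp add: C_def)
  have card: "1 \<le> real CARD('n)" by (simp add: Suc_leI)
  have M: "1 \<le> M" using card \<kappa> by (simp add: M_def)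
  define G where "G z = C * ((dist (fst z) p)\<^sup>2 + M * (snd z * (2 - snd z)))
      - (u (fst z + (\<sigma> * snd z) *\<^sub>R e i) - u (fst z - (\<sigma> * snd z) *\<^sub>R e i))" for z
  let ?K = "cball p 1 \<times> {0..1::real}"
  have Gc: "continuous_on ?K G"
    unfolding G_def by (intro continuous_intros continuous_on_compose2[OF uc]) auto
  have "compact ?K" by (intro compact_Times compact_cball compact_Icc)
  moreover have "?K \<noteq> {}" by auto
  ultimately obtain z where z: "z \<in> ?K" "\<And>y. y \<in> ?K \<Longrightarrow> G z \<le> G y"
    using continuous_attains_inf[OF _ _ Gc] by metis
  obtain q \<tau> where zq: "z = (q, \<tau>)" by (cases z)
  have q: "dist q p \<le> 1" and \<tau>: "0 \<le> \<tau>" "\<tau> \<le> 1" using z(1) by (auto simp: zq dist_commute)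
  have "0 \<le> G z"
  proof (rule ccontr)
    assume "\<not> 0 \<le> G z"
    then have neg: "C * ((dist q p)\<^sup>2 + M * (\<tau> * (2 - \<tau>))) < u (q + (\<sigma> * \<tau>) *\<^sub>R e i) - u (q - (\<sigma> * \<tau>) *\<^sub>R e i)"
      by (simp add: G_def zq)
    then have neg1: "C * ((dist q p)\<^sup>2 + M * (\<tau> * (2 - \<tau>))) < 1"
      using range[of "q + (\<sigma> * \<tau>) *\<^sub>R e i"] range[of "q - (\<sigma> * \<tau>) *\<^sub>R e i"] by linarith
    have "0 \<le> M * (\<tau> * (2 - \<tau>))" using M \<tau> by simp
    then have neg2: "(dist q p)\<^sup>2 + M * (\<tau> * (2 - \<tau>)) < 1"
      using neg1 C mult_right_mono[of 1 C "(dist q p)\<^sup>2 + M * (\<tau> * (2 - \<tau>))"] by simp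
    have "(dist q p)\<^sup>2 < 1" using neg2 \<open>0 \<le> M * (\<tau> * (2 - \<tau>))\<close> by simp
    then have q1: "dist q p < 1" by (simp add: power_less_one_iff abs_square_less_1)
    have \<tau>0: "0 < \<tau>"
    proof (rule ccontr)
      assume "\<not> 0 < \<tau>"
      then have "\<tau> = 0" using \<tau> by simp
      then show False using neg C by (simp add: mult_less_0_iff)
    qed
    have \<tau>1: "\<tau> < 1"
    proof (rule ccontr)
      assume "\<not> \<tau> < 1"
      then have "\<tau> = 1" using \<tau> by simp
      then show False using neg2 M zero_le_power2[of "dist q p"] by simp
    qed
    define P where "P = q + (\<sigma> * \<tau>) *\<^sub>R e i"
    define Q where "Q = q - (\<sigma> * \<tau>) *\<^sub>R e i"
    \<comment> \<open>derivative tests in \<open>x\<^sub>j\<close>; the case \<open>j = i\<close> is needed for the drift only\<close>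
    have horizontal: "u1 j P - u1 j Q = 2 * C * (q - p) $ j \<and> u2 j P - u2 j Q \<le> 2 * C" for j
    proof -
      define g where "g t = C * ((dist q p)\<^sup>2 + 2 * t * (q - p) $ j + t\<^sup>2 + M * (\<tau> * (2 - \<tau>)))
         - (u (P + t *\<^sub>R e j) - u (Q + t *\<^sub>R e j))" for t
      define g' where "g' t = C * (2 * (q - p) $ j + 2 * t)
         - (u1 j (P + t *\<^sub>R e j) - u1 j (Q + t *\<^sub>R e j))" for t
      have dg: "(g has_real_derivative g' t) (at t)" for t
        unfolding g_def g'_def by (auto intro!: derivative_eq_intros d1)
      have "(g' has_real_derivative C * 2 - (u2 j (P + 0 *\<^sub>R e j) - u2 j (Q + 0 *\<^sub>R e j))) (at 0)"
        unfolding g'_def by (auto intro!: derivative_eq_intros DERIV_cong[OF d2] simp del: scale_zero_left)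
      then have dg': "(g' has_real_derivative C * 2 - (u2 j P - u2 j Q)) (at 0)" by simp
      have gG: "g t = G (q + t *\<^sub>R e j, \<tau>)" for t
      proof -
        have "(dist (q + t *\<^sub>R e j) p)\<^sup>2 = (norm ((q - p) + t *\<^sub>R e j))\<^sup>2"
          by (simp add: dist_norm algebra_simps)
        also have "\<dots> = (q - p) \<bullet> (q - p) + 2 * t * ((q - p) \<bullet> e j) + t\<^sup>2"
          unfolding power2_norm_eq_inner e_def
          by (simp add: inner_add_left inner_add_right inner_commute inner_axis_axis power2_eq_square
              del: inner_diff_left inner_diff_right)
        finally have "(dist (q + t *\<^sub>R e j) p)\<^sup>2 = (dist q p)\<^sup>2 + 2 * t * (q - p) $ j + t\<^sup>2"
          by (simp add: dist_norm power2_norm_eq_inner e_def inner_axis)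
        moreover have "q + t *\<^sub>R e j + (\<sigma> * \<tau>) *\<^sub>R e i = P + t *\<^sub>R e j"
          "q + t *\<^sub>R e j - (\<sigma> * \<tau>) *\<^sub>R e i = Q + t *\<^sub>R e j"
          by (simp_all add: P_def Q_def algebra_simps)
        ultimately show ?thesis unfolding g_def G_def fst_conv snd_conv by (simp only:)
      qed
      have loc: "g 0 \<le> g t" if "\<bar>t\<bar> < 1 - dist q p" for t
      proof -
        have "dist (q + t *\<^sub>R e j) p \<le> dist (q + t *\<^sub>R e j) q + dist q p" by (rule dist_triangle)
        also have "dist (q + t *\<^sub>R e j) q = \<bar>t\<bar>" by (simp add: dist_norm e_def)
        finally have "(q + t *\<^sub>R e j, \<tau>) \<in> ?K" using that \<tau> by (simp add: dist_commute)
        from z(2)[OF this] show ?thesis by (simp add: gG zq)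
      qed
      from second_derivative_nonneg_at_local_min[where d = "1 - dist q p", OF dg dg' _ loc] q1
      have "g' 0 = 0" "0 \<le> C * 2 - (u2 j P - u2 j Q)" by auto
      then show ?thesis by (simp add: g'_def algebra_simps)
    qed
    \<comment> \<open>second derivative test in \<open>s\<close>\<close>
    have vertical: "u2 i P - u2 i Q \<le> - 2 * C * M"
    proof -
      define g where "g t = C * ((dist q p)\<^sup>2 + M * ((\<tau> + t) * (2 - (\<tau> + t))))
         - (u (P + (\<sigma> * t) *\<^sub>R e i) - u (Q + (- \<sigma> * t) *\<^sub>R e i))" for t
      define g' where "g' t = C * (M * (2 - 2 * (\<tau> + t)))
         - (u1 i (P + (\<sigma> * t) *\<^sub>R e i) * \<sigma> + u1 i (Q + (- \<sigma> * t) *\<^sub>R e i) * \<sigma>)" for t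
      have ch1: "((\<lambda>t. u (x + (a * t) *\<^sub>R e i)) has_real_derivative u1 i (x + (a * t) *\<^sub>R e i) * a) (at t)" for x a t
        by (rule DERIV_chain2[where f = "\<lambda>s. u (x + s *\<^sub>R e i)" and g = "\<lambda>t. a * t", OF d1])
          (auto intro!: derivative_eq_intros)
      have ch2: "((\<lambda>t. u1 i (x + (a * t) *\<^sub>R e i)) has_real_derivative u2 i (x + (a * t) *\<^sub>R e i) * a) (at t)" for x a t
        by (rule DERIV_chain2[where f = "\<lambda>s. u1 i (x + s *\<^sub>R e i)" and g = "\<lambda>t. a * t", OF d2])
          (auto intro!: derivative_eq_intros)
      have dg: "(g has_real_derivative g' t) (at t)" for t
        unfolding g_def g'_def
        by (rule DERIV_cong, (rule ch1 derivative_eq_intros refl)+) (simp add: algebra_simps)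
      have "(g' has_real_derivative C * (M * (- 2))
         - (u2 i (P + (\<sigma> * 0) *\<^sub>R e i) * \<sigma> * \<sigma> + u2 i (Q + (- \<sigma> * 0) *\<^sub>R e i) * (- \<sigma>) * \<sigma>)) (at 0)"
        unfolding g'_def
        by (rule DERIV_cong, (rule ch2 derivative_eq_intros refl)+) (simp add: algebra_simps)
      then have dg': "(g' has_real_derivative - 2 * C * M - (u2 i P - u2 i Q)) (at 0)"
        using \<sigma> by (elim disjE) (simp_all add: mult_ac)
      have gG: "g t = G (q, \<tau> + t)" for t
      proof -
        have "q + (\<sigma> * (\<tau> + t)) *\<^sub>R e i = P + (\<sigma> * t) *\<^sub>R e i"
          "q - (\<sigma> * (\<tau> + t)) *\<^sub>R e i = Q + (- \<sigma> * t) *\<^sub>R e i"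
          by (simp_all add: P_def Q_def algebra_simps)
        then show ?thesis by (simp add: g_def G_def)
      qed
      have loc: "g 0 \<le> g t" if "\<bar>t\<bar> < min \<tau> (1 - \<tau>)" for t
      proof -
        have "(q, \<tau> + t) \<in> ?K" using that q by (auto simp: dist_commute)
        from z(2)[OF this] show ?thesis by (simp add: gG zq)
      qed
      from second_derivative_nonneg_at_local_min(2)[where d = "min \<tau> (1 - \<tau>)", OF dg dg' _ loc] \<tau>0 \<tau>1
      show ?thesis by auto
    qed
    have "(\<Sum>j\<in>UNIV. u2 j P) - (\<Sum>j\<in>UNIV. u2 j Q) = (\<Sum>j\<in>UNIV. u2 j P - u2 j Q)"
      by (simp add: sum_subtractf)
    also have "\<dots> = (\<Sum>j\<in>UNIV - {i}. u2 j P - u2 j Q) + (u2 i P - u2 i Q)"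
      by (simp add: sum.remove[of UNIV i])
    also have "\<dots> \<le> (\<Sum>j\<in>UNIV - {i}. 2 * C) + - 2 * C * M"
      using horizontal vertical by (intro add_mono sum_mono) auto
    also have "\<dots> = 2 * C * (real CARD('n) - 1 - M)"
      by (simp add: card_Diff_singleton of_nat_diff Suc_leI algebra_simps)
    also have "\<dots> = - 2 * C * \<kappa> - 4 * C" by (simp add: M_def algebra_simps)
    finally have upper: "(\<Sum>j\<in>UNIV. u2 j P) - (\<Sum>j\<in>UNIV. u2 j Q) \<le> - 2 * C * \<kappa> - 4 * C" .
    have "\<kappa> * u1 k P - \<kappa> * u1 k Q - 2 * F \<le> (\<Sum>j\<in>UNIV. u2 j P) - (\<Sum>j\<in>UNIV. u2 j Q)"
      using pde[of P] pde[of Q] by linarith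
    moreover have "\<kappa> * u1 k P - \<kappa> * u1 k Q = 2 * C * \<kappa> * (q - p) $ k"
      using arg_cong[OF conjunct1[OF horizontal[of k]], of "\<lambda>a. \<kappa> * a"] by (simp add: algebra_simps)
    moreover have "- 1 \<le> (q - p) $ k"
      using component_le_norm_cart[of "q - p" k] q1 by (simp add: dist_norm)
    then have "2 * C * \<kappa> * (- 1) \<le> 2 * C * \<kappa> * (q - p) $ k"
      using C \<kappa> by (intro mult_left_mono) auto
    ultimately have "4 * C \<le> 2 * F" using upper by simp
    then show False using C by (simp add: C_def)
  qed
  also have "G z \<le> G (p, s)" using z(2)[of "(p, s)"] s by simp
  finally have "u (p + (\<sigma> * s) *\<^sub>R e i) - u (p - (\<sigma> * s) *\<^sub>R e i) \<le> C * M * (s * (2 - s))"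
    by (simp add: G_def mult.assoc)
  also have "\<dots> \<le> C * M * (2 * s)"
    using C M s by (intro mult_left_mono) (auto simp: algebra_simps)
  finally show ?thesis by (simp add: e_def C_def M_def algebra_simps)
qed

text \<open>Steps of length at most 2 are covered by the doubling estimate at the midpoint, applied with
  both signs of \<open>\<sigma>\<close>; for longer ones the bound \<open>0 < u < 1\<close> suffices.\<close>

lemma bounded_solution_lipschitz:
  fixes u :: "real^'n \<Rightarrow> real" and k :: 'n
  assumes ld: "line_derivs u u1 u2" and \<kappa>: "0 \<le> \<kappa>"
    and range: "\<And>x. 0 < u x \<and> u x < 1"
    and pde: "\<And>x. \<bar>- (\<Sum>i\<in>UNIV. u2 i x) + \<kappa> * u1 k x\<bar> \<le> F"
  obtains K where "0 < K" "\<And>x h. \<bar>u (x + h) - u x\<bar> \<le> K * norm h"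
proof -
  define K0 where "K0 = (F + 1) * (real CARD('n) + \<kappa> + 1)"
  have F: "0 \<le> F" using pde[of 0] by linarith
  have K0: "1 \<le> K0"
    using F \<kappa> mult_mono[of 1 "F + 1" 1 "real CARD('n) + \<kappa> + 1"] by (simp add: K0_def)
  have "\<bar>u (x + s *\<^sub>R axis i 1) - u x\<bar> \<le> K0 * \<bar>s\<bar>" for x i s
  proof (cases "\<bar>s\<bar> \<le> 2")
    case True
    define p :: "real^'n" where "p = x + (s / 2) *\<^sub>R axis i 1"
    have p: "p + (s / 2) *\<^sub>R axis i 1 = x + s *\<^sub>R axis i 1" "p - (s / 2) *\<^sub>R axis i 1 = x"
      by (simp_all add: p_def add.assoc flip: scaleR_left_distrib)
    define \<sigma> :: real where "\<sigma> = (if 0 \<le> s then 1 else -1)"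
    have \<sigma>: "\<sigma> * (\<bar>s\<bar> / 2) = s / 2" "\<sigma> = 1 \<or> \<sigma> = -1" "- \<sigma> = 1 \<or> - \<sigma> = -1" by (auto simp: \<sigma>_def)
    have \<sigma>': "(- \<sigma>) * (\<bar>s\<bar> / 2) = - (s / 2)" using \<sigma>(1) by simp
    have K0s: "2 * (F + 1) * (real CARD('n) + \<kappa> + 1) * (\<bar>s\<bar> / 2) = K0 * \<bar>s\<bar>"
      by (simp add: K0_def algebra_simps)
    have "u (p + (s / 2) *\<^sub>R axis i 1) - u (p - (s / 2) *\<^sub>R axis i 1) \<le> K0 * \<bar>s\<bar>"
      "u (p + (- (s / 2)) *\<^sub>R axis i 1) - u (p - (- (s / 2)) *\<^sub>R axis i 1) \<le> K0 * \<bar>s\<bar>"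
      using bounded_solution_increment_bound[OF ld \<kappa> range pde \<sigma>(2), of "\<bar>s\<bar> / 2" p i]
        bounded_solution_increment_bound[OF ld \<kappa> range pde \<sigma>(3), of "\<bar>s\<bar> / 2" p i] True
      unfolding \<sigma>(1) \<sigma>' K0s by simp_all
    then show ?thesis
      unfolding scaleR_minus_left diff_minus_eq_add p by (simp add: p abs_le_iff)
  next
    case False
    then have "1 \<le> K0 * \<bar>s\<bar>" using K0 mult_mono[of 1 K0 1 "\<bar>s\<bar>"] by simp
    then show ?thesis using range[of x] range[of "x + s *\<^sub>R axis i 1"] by linarith
  qed
  from lipschitz_from_axis_steps[OF _ this] K0
  have "\<And>x h. \<bar>u (x + h) - u x\<bar> \<le> K0 * real CARD('n) * norm h" by simp
  moreover have "0 < K0 * real CARD('n)" using K0 by simp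
  ultimately show thesis using that by blast
qed

section \<open>Cones of directions\<close>

lemma horiz_simps [simp]:
  "horiz k (x + y) = horiz k x + horiz k y" "horiz k (x - y) = horiz k x - horiz k y"
  "horiz k (s *\<^sub>R x) = s *\<^sub>R horiz k x" "horiz k (axis k a) = 0"
  by (auto simp: horiz_def vec_eq_iff axis_def)

lemma horiz_decomposition: "horiz k x + (x $ k) *\<^sub>R axis k 1 = x"
  by (auto simp: horiz_def vec_eq_iff axis_def)

lemma norm_horiz_le: "norm (horiz k x) \<le> norm x"
  by (rule norm_le_componentwise_cart) (auto simp: horiz_def)

definition cone :: "'n::finite \<Rightarrow> real \<Rightarrow> (real^'n) set" where
  "cone k \<beta> = {h. norm (horiz k h) \<le> \<beta> * h $ k}"

lemma cone_scaleR: "h \<in> cone k \<beta> \<Longrightarrow> 0 \<le> s \<Longrightarrow> s *\<^sub>R h \<in> cone k \<beta>"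
  using mult_left_mono[of "norm (horiz k h)" "\<beta> * h $ k" s] by (simp add: cone_def mult_ac)

lemma cone_height_nonneg: "h \<in> cone k \<beta> \<Longrightarrow> 0 < \<beta> \<Longrightarrow> 0 \<le> h $ k"
  using order_trans[OF norm_ge_zero[of "horiz k h"], of "\<beta> * h $ k"]
  by (auto simp: cone_def zero_le_mult_iff)

lemma cone_half_subset: "h \<in> cone k (\<beta> / 2) \<Longrightarrow> 0 < \<beta> \<Longrightarrow> h \<in> cone k \<beta>"
  using norm_ge_zero[of "horiz k h"] unfolding cone_def mem_Collect_eq times_divide_eq_left by linarith

lemma axis_in_cone: "0 \<le> s \<Longrightarrow> 0 \<le> \<beta> \<Longrightarrow> s *\<^sub>R axis k 1 \<in> cone k \<beta>"
  by (simp add: cone_def)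

section \<open>Monotonicity by sliding\<close>

text \<open>What the sliding argument uses of the wave and of the nonlinearity. The three assumptions
  \<open>level\<close>, \<open>vertical\<close> and \<open>gradient\<close> express what the properties of \<open>b\<^sub>0\<close> mean for
  the wave profile, and \<open>f_anti\<close> is what the bistable and the combustion case have in common near \<open>0\<close>.\<close>

locale front =
  fixes f :: "real \<Rightarrow> real" and L \<delta> \<kappa> b c C :: real and v :: "real^'n \<Rightarrow> real" and k :: 'n
  assumes L: "0 \<le> L" and f_lip: "\<And>s t. s \<in> {0..1} \<Longrightarrow> t \<in> {0..1} \<Longrightarrow> \<bar>f s - f t\<bar> \<le> L * \<bar>s - t\<bar>"
    and f0: "f 0 = 0"
    and \<delta>: "0 < \<delta>" "\<delta> < 1 - b" and f_anti: "\<And>s t. 0 \<le> s \<Longrightarrow> s \<le> t \<Longrightarrow> t \<le> \<delta> \<Longrightarrow> f t \<le> f s"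
    and \<kappa>: "0 < \<kappa>" and b: "0 < b" "b < 1" and c: "0 < c" and C: "0 < C"
    and C2: "C2 v" and range: "\<And>x. 0 < v x \<and> v x < 1"
    and pde: "\<And>x. - laplacian v x + \<kappa> * partial k v x = f (v x)"
    and vanish: "vanishes_away_from {y. v y \<ge> 1 - b} v"
    and level: "\<And>l x. 1 - b \<le> l \<Longrightarrow> l < 1 \<Longrightarrow> \<exists>!t. v (x + t *\<^sub>R axis k 1) = l"
    and vertical: "\<And>x. 1 - b < v x \<Longrightarrow> c * (1 - v x) \<le> partial k v x"
    and gradient: "\<And>x. 1 - b < v x \<Longrightarrow> norm (grad v x) \<le> C * (1 - v x)"
begin

text \<open>Half of the vertical growth \<open>c h\<^sub>n (1 - v)\<close> is left to compensate the horizontal variation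
  \<open>C \<bar>h'\<bar> (1 - v)\<close>.\<close>

definition slope :: real where "slope = c / (2 * C)"

lemma slope_pos: "0 < slope" using c C by (simp add: slope_def)

lemma diff_v: "v differentiable (at x)" using C2 by (simp add: C2_def)

lemma line_deriv: "((\<lambda>s. v (x + s *\<^sub>R h)) has_real_derivative grad v (x + t *\<^sub>R h) \<bullet> h) (at t)"
  using derivative_along_line[of v] diff_v by blast

lemma line_cont: "continuous_on S (\<lambda>s. v (x + s *\<^sub>R h))"
  by (rule DERIV_continuous_on) (rule has_field_derivative_at_within[OF line_deriv])

lemma level_attained: "1 - b \<le> l \<Longrightarrow> l < 1 \<Longrightarrow> \<exists>t. v (x + t *\<^sub>R axis k 1) = l"
  using level by blast

lemma cone_derivative:
  assumes "1 - b < v x" "h \<in> cone k slope"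
  shows "c / 2 * h $ k * (1 - v x) \<le> grad v x \<bullet> h"
proof -
  have "grad v x \<bullet> h = grad v x \<bullet> (horiz k h + (h $ k) *\<^sub>R axis k 1)"
    by (simp add: horiz_decomposition)
  also have "\<dots> = grad v x \<bullet> horiz k h + h $ k * partial k v x"
    by (simp add: inner_add_right inner_grad_axis)
  finally have eq: "grad v x \<bullet> h = grad v x \<bullet> horiz k h + h $ k * partial k v x" .
  have "\<bar>grad v x \<bullet> horiz k h\<bar> \<le> norm (grad v x) * norm (horiz k h)"
    by (rule Cauchy_Schwarz_ineq2)
  also have "\<dots> \<le> (C * (1 - v x)) * (slope * h $ k)"
    using gradient[OF assms(1)] assms(2) C range[of x] by (intro mult_mono) (auto simp: cone_def)
  also have "\<dots> = c / 2 * h $ k * (1 - v x)" using C by (simp add: slope_def)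
  finally have "- (c / 2 * h $ k * (1 - v x)) \<le> grad v x \<bullet> horiz k h" by linarith
  moreover have "h $ k * (c * (1 - v x)) \<le> h $ k * partial k v x"
    using vertical[OF assms(1)] cone_height_nonneg[OF assms(2) slope_pos] by (intro mult_left_mono)
  moreover have "c / 2 * h $ k * (1 - v x) = h $ k * (c * (1 - v x)) / 2" by simp
  ultimately show ?thesis unfolding eq by linarith
qed

lemma cone_derivative_nonneg:
  assumes "1 - b < v x" "h \<in> cone k slope"
  shows "0 \<le> grad v x \<bullet> h"
proof -
  have "0 \<le> c / 2 * h $ k * (1 - v x)"
    using c range[of x] cone_height_nonneg[OF assms(2) slope_pos] by simp
  then show ?thesis using cone_derivative[OF assms] by linarith
qed

text \<open>At the first point of the segment where \<open>v \<le> 1 - b\<close> the mean value theorem would give a value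
  no smaller than \<open>v x\<close>.\<close>

lemma cone_stays:
  assumes x: "1 - b < v x" and h: "h \<in> cone k slope"
  shows "1 - b < v (x + h)"
proof (rule ccontr)
  assume low: "\<not> 1 - b < v (x + h)"
  define T where "T = {0..1} \<inter> {s. v (x + s *\<^sub>R h) \<le> 1 - b}"
  have "closed {s. v (x + s *\<^sub>R h) \<le> 1 - b}"
    by (intro closed_Collect_le line_cont continuous_on_const)
  then have "compact T" unfolding T_def by (intro compact_Int_closed compact_Icc)
  moreover have "1 \<in> T" using low by (simp add: T_def)
  ultimately obtain a where a: "a \<in> T" "\<And>s. s \<in> T \<Longrightarrow> a \<le> s"
    by (metis compact_attains_inf empty_iff)
  have a01: "0 \<le> a" "a \<le> 1" "v (x + a *\<^sub>R h) \<le> 1 - b" using a(1) by (auto simp: T_def)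
  have "a \<noteq> 0" using a01(3) x by auto
  then have "0 < a" using a01 by simp
  then obtain s where s: "0 < s" "s < a"
      "v (x + a *\<^sub>R h) - v (x + 0 *\<^sub>R h) = (a - 0) * (grad v (x + s *\<^sub>R h) \<bullet> h)"
    using MVT2[of 0 a "\<lambda>s. v (x + s *\<^sub>R h)" "\<lambda>s. grad v (x + s *\<^sub>R h) \<bullet> h"] line_deriv by blast
  have "s \<notin> T" using a(2)[of s] s by auto
  then have "1 - b < v (x + s *\<^sub>R h)" using s a01 by (auto simp: T_def)
  from cone_derivative_nonneg[OF this h] have "0 \<le> v (x + a *\<^sub>R h) - v (x + 0 *\<^sub>R h)"
    unfolding s(3) using \<open>0 < a\<close> by simp
  then show False using a01 x by simp
qed

lemma cone_mean_value:
  assumes x: "1 - b < v x" and h: "h \<in> cone k slope"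
  obtains s where "0 < s" "s < 1" "1 - b < v (x + s *\<^sub>R h)"
    "v (x + h) - v x = grad v (x + s *\<^sub>R h) \<bullet> h"
proof -
  obtain s where s: "0 < s" "s < 1"
      "v (x + 1 *\<^sub>R h) - v (x + 0 *\<^sub>R h) = (1 - 0) * (grad v (x + s *\<^sub>R h) \<bullet> h)"
    using MVT2[of 0 1 "\<lambda>s. v (x + s *\<^sub>R h)" "\<lambda>s. grad v (x + s *\<^sub>R h) \<bullet> h"] line_deriv by force
  have "1 - b < v (x + s *\<^sub>R h)"
    using cone_stays[OF x cone_scaleR[OF h]] s by simp
  with s that show thesis by simp
qed

lemma cone_increasing:
  assumes x: "1 - b < v x" and h: "h \<in> cone k slope"
  shows "v x \<le> v (x + h)"
proof -
  obtain s where s: "0 < s" "s < 1" "1 - b < v (x + s *\<^sub>R h)"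
    "v (x + h) - v x = grad v (x + s *\<^sub>R h) \<bullet> h"
    using cone_mean_value[OF x h] by blast
  with cone_derivative_nonneg[OF s(3) h] show ?thesis by simp
qed

text \<open>A bound without exponentials in terms of the endpoint: since \<open>v\<close> is nondecreasing on the
  segment, the rate \<open>1 - v\<close> is smallest there. Solved for \<open>1 - v (x + h)\<close> it shows how close to \<open>1\<close> a
  long step leads; solved for \<open>v (x + h) - v x\<close> it gives a gain proportional to \<open>1 - v x\<close>.\<close>

lemma cone_gain:
  assumes x: "1 - b < v x" and h: "h \<in> cone k slope"
  shows "c / 2 * h $ k * (1 - v (x + h)) \<le> v (x + h) - v x"
proof -
  obtain s where s: "0 < s" "s < 1" "1 - b < v (x + s *\<^sub>R h)"
    "v (x + h) - v x = grad v (x + s *\<^sub>R h) \<bullet> h"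
    using cone_mean_value[OF x h] by blast
  have "(1 - s) *\<^sub>R h \<in> cone k slope" using cone_scaleR[OF h] s by simp
  from cone_increasing[OF s(3) this] have "v (x + s *\<^sub>R h) \<le> v (x + h)"
    by (simp add: algebra_simps)
  then have "c / 2 * h $ k * (1 - v (x + h)) \<le> c / 2 * h $ k * (1 - v (x + s *\<^sub>R h))"
    using c cone_height_nonneg[OF h slope_pos] by (intro mult_left_mono) auto
  with cone_derivative[OF s(3) h] s(4) show ?thesis by simp
qed

text \<open>The derivative estimates are void on \<open>{v = 1 - b}\<close> itself. From there on, uniqueness of the level
  \<open>1 - b\<close> on the vertical line leaves only one sign for \<open>v - (1 - b)\<close> above \<open>y\<close>, and the point where
  \<open>v = 1 - b/2\<close> cannot lie below \<open>y\<close>, so the sign is positive.\<close>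

lemma enter_upper_region:
  assumes y: "1 - b \<le> v y"
  shows "1 - b < v (y + axis k 1)"
proof (cases "1 - b < v y")
  case True
  then show ?thesis using cone_stays[OF True axis_in_cone[of 1 slope k]] slope_pos by simp
next
  case False
  then have vy: "v y = 1 - b" using y by simp
  define u where "u t = v (y + t *\<^sub>R axis k 1)" for t
  have uc: "continuous_on S u" for S unfolding u_def by (rule line_cont)
  have u0: "u 0 = 1 - b" by (simp add: u_def vy)
  have once: "t = 0" if "u t = 1 - b" for t
  proof -
    have "\<exists>!t. u t = 1 - b" unfolding u_def using b by (intro level) auto
    then show ?thesis using that u0 by blast
  qed
  obtain t where t: "u t = 1 - b / 2"
    using level_attained[of "1 - b / 2" y] b by (auto simp: u_def)
  have "0 < t"
  proof (rule ccontr)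
    assume "\<not> 0 < t"
    then have "(- t) *\<^sub>R axis k 1 \<in> cone k slope" using slope_pos by (intro axis_in_cone) auto
    moreover have "1 - b < v (y + t *\<^sub>R axis k 1)" using t b by (simp add: u_def)
    ultimately have "v (y + t *\<^sub>R axis k 1) \<le> v (y + t *\<^sub>R axis k 1 + (- t) *\<^sub>R axis k 1)"
      using cone_increasing by blast
    then show False using t vy b by (simp add: u_def)
  qed
  have "1 - b < u 1"
  proof (rule ccontr)
    assume "\<not> 1 - b < u 1"
    then have low: "u 1 < 1 - b" using once[of 1] by fastforce
    show False
    proof (cases "t \<le> 1")
      case True
      obtain s where "t \<le> s" "u s = 1 - b"
        using IVT2'[of u 1 "1 - b" t] low t b True uc by auto
      then show False using once[of s] \<open>0 < t\<close> by simp
    next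
      case False
      obtain s where "1 \<le> s" "u s = 1 - b"
        using IVT'[of u 1 "1 - b" t] low t b False uc by auto
      then show False using once[of s] by simp
    qed
  qed
  then show ?thesis by (simp add: u_def)
qed

lemma superlevel_nonempty: "\<exists>y. 1 - b \<le> v y"
  using level_attained[of "1 - b" 0] b by (metis order_refl diff_less_eq less_add_same_cancel1)

text \<open>A point with \<open>v \<ge> d\<close> is at distance less than some \<open>R\<close> from a point \<open>y\<close> with \<open>v y \<ge> 1 - b\<close>. The
  step from \<open>y + e\<^sub>n\<close> to \<open>x + h\<close> lies in the full cone as soon as the height of \<open>h\<close> is large, since the
  direction of \<open>h\<close> is in the smaller cone and the bounded offset uses up the difference.\<close>

lemma uniform_lift:
  assumes d: "0 < d"
  obtains H where "0 \<le> H"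
    "\<And>x h. d \<le> v x \<Longrightarrow> h \<in> cone k (slope / 2) \<Longrightarrow> H \<le> h $ k \<Longrightarrow> 1 - b / 2 \<le> v (x + h)"
proof -
  obtain R0 where R0: "\<And>x. R0 \<le> infdist x {y. 1 - b \<le> v y} \<Longrightarrow> \<bar>v x\<bar> < d"
    using vanish d unfolding vanishes_away_from_def by meson
  define R where "R = max R0 0"
  have R: "0 \<le> R" "\<And>x. R \<le> infdist x {y. 1 - b \<le> v y} \<Longrightarrow> \<bar>v x\<bar> < d"
    using R0 by (auto simp: R_def)
  \<comment> \<open>the first entry makes the step long enough to halve \<open>1 - v\<close>, the second keeps it in the cone\<close>
  define H where "H = max (2 / c + R + 1) (2 * (R / slope + R + 1))"
  have "0 \<le> H" using R c by (simp add: H_def le_max_iff_disj)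
  moreover have "1 - b / 2 \<le> v (x + h)"
    if x: "d \<le> v x" and h: "h \<in> cone k (slope / 2)" and hH: "H \<le> h $ k" for x h
  proof -
    have "infdist x {y. 1 - b \<le> v y} < R" using R(2)[of x] x by force
    then obtain y where y: "1 - b \<le> v y" "dist x y < R"
      using superlevel_nonempty by (auto simp: infdist_def cInf_less_iff split: if_splits)
    define q where "q = y + axis k 1"
    define g where "g = (x - y) - axis k 1 + h"
    have q: "1 - b < v q" unfolding q_def by (rule enter_upper_region[OF y(1)])
    have xh: "x + h = q + g" by (simp add: q_def g_def)
    have "\<bar>(x - y) $ k\<bar> \<le> norm (x - y)" by (rule component_le_norm_cart)
    then have "\<bar>x $ k - y $ k\<bar> < R" using y(2) by (simp add: dist_norm)
    then have gk: "h $ k - R - 1 \<le> g $ k" by (simp add: g_def axis_def)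
    have "norm (horiz k g) \<le> norm (horiz k (x - y)) + norm (horiz k h)"
      using norm_triangle_ineq[of "horiz k (x - y)" "horiz k h"] by (simp add: g_def)
    also have "\<dots> \<le> R + slope / 2 * h $ k"
      using norm_horiz_le[of k "x - y"] y(2) h by (simp add: cone_def dist_norm)
    also have "\<dots> \<le> slope * (h $ k - R - 1)"
    proof -
      have "slope * (2 * (R / slope + R + 1)) \<le> slope * h $ k"
        using hH slope_pos by (intro mult_left_mono) (auto simp: H_def)
      then show ?thesis using slope_pos by (simp add: algebra_simps)
    qed
    also have "\<dots> \<le> slope * g $ k" using gk slope_pos by (intro mult_left_mono) auto
    finally have g: "g \<in> cone k slope" by (simp add: cone_def)
    have "2 / c \<le> g $ k" using gk hH by (simp add: H_def)
    then have "1 \<le> c / 2 * g $ k" using c by (simp add: field_simps)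
    then have "1 * (1 - v (q + g)) \<le> c / 2 * g $ k * (1 - v (q + g))"
      using range[of "q + g"] by (intro mult_right_mono) auto
    also have "\<dots> \<le> v (q + g) - v q" by (rule cone_gain[OF q g])
    finally show ?thesis using q by (simp add: xh)
  qed
  ultimately show thesis using that by blast
qed

lemma nearby_reference_point:
  assumes d: "0 < d"
  obtains H where "0 \<le> H"
    "\<And>x. d \<le> v x \<Longrightarrow> v x \<le> 1 - b / 2 \<Longrightarrow> \<exists>p. dist x p \<le> H \<and> v p = 1 - b / 2"
proof -
  obtain H where H: "0 \<le> H"
    "\<And>x h. d \<le> v x \<Longrightarrow> h \<in> cone k (slope / 2) \<Longrightarrow> H \<le> h $ k \<Longrightarrow> 1 - b / 2 \<le> v (x + h)"
    using uniform_lift[OF d] by blast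
  have "\<exists>p. dist x p \<le> H \<and> v p = 1 - b / 2" if x: "d \<le> v x" "v x \<le> 1 - b / 2" for x
  proof -
    have "1 - b / 2 \<le> v (x + H *\<^sub>R axis k 1)"
      using H slope_pos x by (intro H(2) axis_in_cone) auto
    then obtain s where s: "0 \<le> s" "s \<le> H" "v (x + s *\<^sub>R axis k 1) = 1 - b / 2"
      using IVT'[of "\<lambda>s. v (x + s *\<^sub>R axis k 1)" 0 "1 - b / 2" H] x H(1) line_cont by auto
    then show ?thesis by (intro exI[of _ "x + s *\<^sub>R axis k 1"]) (simp add: dist_norm)
  qed
  with H(1) that show thesis by blast
qed

lemma lipschitz:
  obtains K where "0 < K" "\<And>x h. \<bar>v (x + h) - v x\<bar> \<le> K * norm h"
proof (rule bounded_solution_lipschitz[OF line_derivs_C2[OF C2] less_imp_le[OF \<kappa>] range])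
  show "\<bar>- (\<Sum>i\<in>UNIV. partial i (partial i v) x) + \<kappa> * partial k v x\<bar> \<le> L" for x
  proof -
    have "\<bar>f (v x)\<bar> \<le> L * \<bar>v x\<bar>" using f_lip[of "v x" 0] f0 range[of x] by simp
    also have "\<dots> \<le> L * 1" using L range[of x] by (intro mult_left_mono) auto
    finally show ?thesis using pde[of x] by (simp add: laplacian_def)
  qed
qed (use that in blast)

lemma reference_ball:
  obtains r where "0 < r"
    "\<And>x p. v p = 1 - b / 2 \<Longrightarrow> dist x p \<le> r \<Longrightarrow> 1 - b < v x \<and> v x \<le> 1 - b / 4"
proof -
  obtain K where K: "0 < K" "\<And>x h. \<bar>v (x + h) - v x\<bar> \<le> K * norm h" using lipschitz by blast
  have "1 - b < v x \<and> v x \<le> 1 - b / 4" if p: "v p = 1 - b / 2" "dist x p \<le> b / (4 * K)" for x p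
  proof -
    have "\<bar>v x - v p\<bar> \<le> K * dist x p" using K(2)[of p "x - p"] by (simp add: dist_norm)
    also have "\<dots> \<le> K * (b / (4 * K))" using p K by (intro mult_left_mono) auto
    also have "\<dots> = b / 4" using K by simp
    finally show ?thesis using p(1) b by linarith
  qed
  then show thesis using that[of "b / (4 * K)"] b K by simp
qed

lemma increment_equation:
  "- (\<Sum>i\<in>UNIV. partial i (partial i v) (x + h) - partial i (partial i v) x)
     + \<kappa> * (partial k v (x + h) - partial k v x) = f (v (x + h)) - f (v x)"
  using pde[of x] pde[of "x + h"] by (simp add: laplacian_def sum_subtractf algebra_simps)

text \<open>The maximum principle in \<open>{v < \<delta>}\<close>, where \<open>f\<close> is nonincreasing. If the increment \<open>z\<close> had
  infimum \<open>- m < 0\<close>, then a point where \<open>z\<close> is close to \<open>- m\<close> has \<open>v \<ge> m/2\<close>, hence lies at bounded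
  distance from a ball of fixed radius in \<open>{v > 1 - b}\<close>. There \<open>z + m \<ge> m\<close>, so the barrier keeps
  \<open>z + m\<close> away from zero, by an amount that is the same for all such points; this contradicts the
  choice of \<open>m\<close>.\<close>

lemma comparison_below:
  assumes above: "\<And>x. \<delta> \<le> v x \<Longrightarrow> v x \<le> v (x + h)"
  shows "v x \<le> v (x + h)"
proof (rule ccontr)
  assume neg: "\<not> v x \<le> v (x + h)"
  define z where "z x = v (x + h) - v x" for x
  define m where "m = - (INF x. z x)"
  have zb: "- 1 \<le> z x" for x using range[of x] range[of "x + h"] by (simp add: z_def)
  have bdd: "bdd_below (range z)" using zb by (meson bdd_belowI2)
  have mz: "0 \<le> z x + m" for x using cINF_lower[OF bdd, of x] by (simp add: m_def)
  have m: "0 < m" using mz[of x] neg by (simp add: z_def)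
  obtain H where H: "0 \<le> H"
    "\<And>x. m / 2 \<le> v x \<Longrightarrow> v x \<le> 1 - b / 2 \<Longrightarrow> \<exists>p. dist x p \<le> H \<and> v p = 1 - b / 2"
    using nearby_reference_point[of "m / 2"] m by auto
  obtain r where r: "0 < r"
    "\<And>x p. v p = 1 - b / 2 \<Longrightarrow> dist x p \<le> r \<Longrightarrow> 1 - b < v x \<and> v x \<le> 1 - b / 4"
    using reference_ball by blast
  obtain a where a: "0 < a" "barrier_constant \<kappa> k 0 r (max r H) a"
    by (rule barrier_constant_exists[OF less_imp_le[OF \<kappa>] order_refl r(1) max.cobounded1])
  have low: "min (m / 2) (a * m) \<le> z x + m" for x
  proof (cases "z x < - (m / 2)")
    case True
    have "\<not> \<delta> \<le> v x" using above[of x] True m by (auto simp: z_def)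
    then have "v x \<le> 1 - b / 2" using \<delta> b by simp
    moreover have "m / 2 \<le> v x" using True range[of "x + h"] by (simp add: z_def)
    ultimately obtain p where p: "dist x p \<le> H" "v p = 1 - b / 2" using H(2) by blast
    have "a * m \<le> v (x + h) - v x + m"
    proof (rule barrier_constantD[OF a(2) line_derivs_increment[OF line_derivs_C2[OF C2]], of h m m p x])
      show "0 \<le> v (x + h) - v x + m" for x using mz[of x] by (simp add: z_def)
      show "0 \<le> - (\<Sum>i\<in>UNIV. partial i (partial i v) (x + h) - partial i (partial i v) x)
        + \<kappa> * (partial k v (x + h) - partial k v x) + 0 * (v (x + h) - v x + m)"
        if "v (x + h) - v x + m < m" for x
      proof -
        have lt: "v (x + h) < v x" using that by simp
        then have "v x < \<delta>" using above[of x] by force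
        then have "f (v x) \<le> f (v (x + h))"
          using lt range[of "x + h"] by (intro f_anti) auto
        then show ?thesis using increment_equation[of x h] by simp
      qed
      show "m \<le> v (x + h) - v x + m" if "dist x p \<le> r" for x
        using above[of x] r(2)[OF p(2) that] \<delta> by simp
    qed (use m p in auto)
    then show ?thesis by (simp add: z_def)
  qed simp
  have "min (m / 2) (a * m) - m \<le> (INF x. z x)"
    by (rule cINF_greatest) (use low in \<open>auto simp: algebra_simps\<close>)
  moreover have "0 < min (m / 2) (a * m)" using m a(1) by simp
  moreover have "(INF x. z x) = - m" by (simp add: m_def)
  ultimately show False by linarith
qed

text \<open>The increment \<open>z\<close> is a supersolution of \<open>- \<Delta> + \<kappa> \<partial>\<^sub>n + L\<close>, and on a ball around \<open>p\<close> it is bounded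
  below by \<open>cone_gain\<close>; the barrier extends a positive lower bound to distance \<open>D\<close>.\<close>

lemma uniform_positivity:
  assumes h: "h \<in> cone k slope" "0 < h $ k" and mono: "\<And>x. v x \<le> v (x + h)" and D: "0 \<le> D"
  obtains \<eta> where "0 < \<eta>" "\<And>x p. v p = 1 - b / 2 \<Longrightarrow> dist x p \<le> D \<Longrightarrow> v x + \<eta> \<le> v (x + h)"
proof -
  define q where "q = c / 2 * h $ k"
  have q: "0 < q" using c h by (simp add: q_def)
  obtain r where r: "0 < r"
    "\<And>x p. v p = 1 - b / 2 \<Longrightarrow> dist x p \<le> r \<Longrightarrow> 1 - b < v x \<and> v x \<le> 1 - b / 4"
    using reference_ball by blast
  obtain a where a: "0 < a" "barrier_constant \<kappa> k L r (max r D) a"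
    by (rule barrier_constant_exists[OF less_imp_le[OF \<kappa>] L r(1) max.cobounded1])
  \<comment> \<open>\<open>cone_gain\<close> solved for the increment, with \<open>1 - v \<ge> b/4\<close> on the ball\<close>
  define \<eta> where "\<eta> = q / (1 + q) * (b / 4)"
  have \<eta>: "0 < \<eta>" using q b by (simp add: \<eta>_def)
  have "v x + a * \<eta> \<le> v (x + h)" if p: "v p = 1 - b / 2" "dist x p \<le> D" for x p
  proof -
    have "a * \<eta> \<le> v (x + h) - v x + 0"
    proof (rule barrier_constantD[OF a(2) line_derivs_increment[OF line_derivs_C2[OF C2]], of h 0 \<eta> p x])
      show "0 \<le> v (x + h) - v x + 0" for x using mono[of x] by simp
      show "0 \<le> - (\<Sum>i\<in>UNIV. partial i (partial i v) (x + h) - partial i (partial i v) x)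
        + \<kappa> * (partial k v (x + h) - partial k v x) + L * (v (x + h) - v x + 0)" for x
      proof -
        have "\<bar>f (v (x + h)) - f (v x)\<bar> \<le> L * \<bar>v (x + h) - v x\<bar>"
          using range[of x] range[of "x + h"] by (intro f_lip) auto
        then show ?thesis using increment_equation[of x h] mono[of x] by simp
      qed
      show "\<eta> \<le> v (x + h) - v x + 0" if "dist x p \<le> r" for x
      proof -
        have x: "1 - b < v x" "v x \<le> 1 - b / 4" using r(2)[OF p(1) that] by auto
        have "q * (1 - v (x + h)) \<le> v (x + h) - v x"
          using cone_gain[OF x(1) h(1)] by (simp add: q_def)
        then have "q * (1 - v x) \<le> (v (x + h) - v x) * (1 + q)" by (simp add: algebra_simps)
        moreover have "q * (b / 4) \<le> q * (1 - v x)" using q x by (intro mult_left_mono) auto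
        ultimately show ?thesis using q by (simp add: \<eta>_def field_simps)
      qed
    qed (use \<eta> p in auto)
    then show ?thesis by simp
  qed
  then show thesis using that[of "a * \<eta>"] a(1) \<eta> by simp
qed

text \<open>The sliding argument: \<open>\<tau>\<close> is the infimum of the shifts from which on \<open>v(\<cdot> + s h) \<ge> v\<close>. By
  \<open>comparison_below\<close> and the monotonicity in \<open>{v > 1 - b}\<close> the order has to be checked only where
  \<open>\<delta> \<le> v \<le> 1 - b\<close>. On that set the order at the shift \<open>\<tau> > 0\<close> holds with a uniform margin \<open>\<eta>\<close>, which the
  Lipschitz bound turns into room for smaller shifts.\<close>

lemma cone_monotone:
  assumes h: "h \<in> cone k (slope / 2)" "0 < h $ k"
  shows "v x \<le> v (x + h)"
proof -
  define T where "T = {\<tau>. 0 \<le> \<tau> \<and> (\<forall>s\<ge>\<tau>. \<forall>x. v x \<le> v (x + s *\<^sub>R h))}"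
  have h': "s *\<^sub>R h \<in> cone k slope" "s *\<^sub>R h \<in> cone k (slope / 2)" if "0 \<le> s" for s
    using cone_half_subset[OF _ slope_pos] cone_scaleR[OF h(1) that] by auto
  have reduce: "v x \<le> v (x + s *\<^sub>R h)"
    if "0 \<le> s" and mid: "\<And>x. \<delta> \<le> v x \<Longrightarrow> v x \<le> 1 - b \<Longrightarrow> v x \<le> v (x + s *\<^sub>R h)" for s x
  proof (rule comparison_below)
    show "v x \<le> v (x + s *\<^sub>R h)" if "\<delta> \<le> v x" for x
      using mid[OF that] cone_increasing[OF _ h'(1)[OF \<open>0 \<le> s\<close>], of x] by fastforce
  qed
  obtain H where H: "0 \<le> H"
    "\<And>x h. \<delta> \<le> v x \<Longrightarrow> h \<in> cone k (slope / 2) \<Longrightarrow> H \<le> h $ k \<Longrightarrow> 1 - b / 2 \<le> v (x + h)"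
    using uniform_lift[OF \<delta>(1)] by blast
  have "H / h $ k \<in> T"
    unfolding T_def
  proof (intro CollectI conjI allI impI)
    show "0 \<le> H / h $ k" using H h by simp
    fix s x assume s: "H / h $ k \<le> s"
    then have s0: "0 \<le> s" using \<open>0 \<le> H / h $ k\<close> by linarith
    have "H \<le> (s *\<^sub>R h) $ k" using s h by (simp add: field_simps)
    then have "v x \<le> v (x + s *\<^sub>R h)" if "\<delta> \<le> v x" "v x \<le> 1 - b" for x
      using H(2)[OF that(1) h'(2)[OF s0]] that b by fastforce
    with reduce[OF s0] show "v x \<le> v (x + s *\<^sub>R h)" by blast
  qed
  then have ne: "T \<noteq> {}" by auto
  have bdd: "bdd_below T" by (rule bdd_belowI[of _ 0]) (simp add: T_def)
  define \<tau> where "\<tau> = Inf T"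
  have \<tau>0: "0 \<le> \<tau>" unfolding \<tau>_def by (rule cInf_greatest[OF ne]) (simp add: T_def)
  have beyond: "v x \<le> v (x + s *\<^sub>R h)" if s: "\<tau> < s" for s x
  proof -
    obtain t where "t \<in> T" "t < s" using cInf_lessD[OF ne, of s] s by (auto simp: \<tau>_def)
    then show ?thesis by (simp add: T_def)
  qed
  \<comment> \<open>the order passes to the limit shift by continuity\<close>
  have at: "v x \<le> v (x + \<tau> *\<^sub>R h)" for x
  proof (rule ccontr)
    assume neg: "\<not> v x \<le> v (x + \<tau> *\<^sub>R h)"
    have "isCont (\<lambda>s. v (x + s *\<^sub>R h)) \<tau>" using line_deriv DERIV_isCont by blast
    then have "((\<lambda>s. v (x + s *\<^sub>R h)) \<longlongrightarrow> v (x + \<tau> *\<^sub>R h)) (at_right \<tau>)"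
      unfolding isCont_def by (rule filterlim_at_split[THEN iffD1, THEN conjunct2])
    then have "v x \<le> v (x + \<tau> *\<^sub>R h)"
      by (rule tendsto_lowerbound)
        (auto simp: eventually_at_filter intro!: always_eventually beyond)
    then show False using neg by simp
  qed
  have "\<tau> = 0"
  proof (rule ccontr)
    assume "\<tau> \<noteq> 0"
    then have \<tau>: "0 < \<tau>" using \<tau>0 by simp
    obtain D where D: "0 \<le> D"
      "\<And>x. \<delta> \<le> v x \<Longrightarrow> v x \<le> 1 - b / 2 \<Longrightarrow> \<exists>p. dist x p \<le> D \<and> v p = 1 - b / 2"
      using nearby_reference_point[OF \<delta>(1)] by blast
    have "0 < (\<tau> *\<^sub>R h) $ k" using \<tau> h by simp
    then obtain \<eta> where \<eta>: "0 < \<eta>"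
      "\<And>x p. v p = 1 - b / 2 \<Longrightarrow> dist x p \<le> D \<Longrightarrow> v x + \<eta> \<le> v (x + \<tau> *\<^sub>R h)"
      using uniform_positivity[OF h'(1)[OF \<tau>0] _ at D(1)] by blast
    obtain K where K: "0 < K" "\<And>x h. \<bar>v (x + h) - v x\<bar> \<le> K * norm h" using lipschitz by blast
    define \<epsilon> where "\<epsilon> = min \<tau> (\<eta> / (K * (norm h + 1)))"
    have \<epsilon>: "0 < \<epsilon>" "\<epsilon> \<le> \<tau>" using \<tau> \<eta> K by (auto simp: \<epsilon>_def intro!: divide_pos_pos mult_pos_pos add_nonneg_pos)
    have "\<tau> - \<epsilon> \<in> T"
      unfolding T_def
    proof (intro CollectI conjI allI impI)
      show "0 \<le> \<tau> - \<epsilon>" using \<epsilon> by simp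
      fix s x assume s: "\<tau> - \<epsilon> \<le> s"
      show "v x \<le> v (x + s *\<^sub>R h)"
      proof (cases "\<tau> < s")
        case True then show ?thesis by (rule beyond)
      next
        case False
        show ?thesis
        proof (rule reduce)
          show "0 \<le> s" using s \<epsilon> by simp
          fix x assume x: "\<delta> \<le> v x" "v x \<le> 1 - b"
          then obtain p where p: "v p = 1 - b / 2" "dist x p \<le> D" using D(2)[of x] b by auto
          have "\<bar>v ((x + \<tau> *\<^sub>R h) + (s - \<tau>) *\<^sub>R h) - v (x + \<tau> *\<^sub>R h)\<bar> \<le> K * norm ((s - \<tau>) *\<^sub>R h)"
            by (rule K(2))
          also have "(x + \<tau> *\<^sub>R h) + (s - \<tau>) *\<^sub>R h = x + s *\<^sub>R h" by (simp add: algebra_simps)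
          also have "K * norm ((s - \<tau>) *\<^sub>R h) \<le> K * (\<epsilon> * (norm h + 1))"
            using K(1) s False by (auto intro!: mult_mono mult_left_mono)
          also have "\<epsilon> * (K * (norm h + 1)) \<le> \<eta> / (K * (norm h + 1)) * (K * (norm h + 1))"
            using K(1) by (intro mult_right_mono) (auto simp: \<epsilon>_def)
          then have "K * (\<epsilon> * (norm h + 1)) \<le> \<eta>"
            using K(1) norm_ge_zero[of h] by (simp add: mult_ac add_nonneg_eq_0_iff)
          finally show "v x \<le> v (x + s *\<^sub>R h)" using \<eta>(2)[OF p] by (simp add: abs_le_iff)
        qed
      qed
    qed
    then have "\<tau> \<le> \<tau> - \<epsilon>" unfolding \<tau>_def using cInf_lower[OF _ bdd] by blast
    then show False using \<epsilon> by simp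
  qed
  then show ?thesis using beyond[of 1 x] by simp
qed

text \<open>Strictness is the barrier estimate again, from the point of the vertical line through \<open>x\<close> at
  which \<open>v = 1 - b/2\<close>.\<close>

lemma cone_strictly_monotone:
  assumes h: "h \<in> cone k (slope / 2)" "0 < h $ k"
  shows "v x < v (x + h)"
proof -
  obtain t where t: "v (x + t *\<^sub>R axis k 1) = 1 - b / 2"
    using level_attained[of "1 - b / 2" x] b by auto
  obtain \<eta> where "0 < \<eta>"
      "\<And>y p. v p = 1 - b / 2 \<Longrightarrow> dist y p \<le> \<bar>t\<bar> \<Longrightarrow> v y + \<eta> \<le> v (y + h)"
    using uniform_positivity[OF cone_half_subset[OF h(1) slope_pos] h(2) cone_monotone[OF h], of "\<bar>t\<bar>"] by auto
  from this(1) this(2)[OF t, of x] show ?thesis by (simp add: dist_norm)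
qed

text \<open>If \<open>v \<ge> l\<close> held on a whole vertical line, then \<open>uniform_lift\<close> would give \<open>v \<ge> 1 - b/2\<close> on it,
  but the level \<open>1 - b\<close> is attained on every line.\<close>

lemma line_crosses_once:
  assumes l: "0 < l" "l < 1"
  shows "\<exists>!t. v (x + t *\<^sub>R axis k 1) = l"
proof -
  define u where "u t = v (x + t *\<^sub>R axis k 1)" for t
  have strict: "u s < u t" if "s < t" for s t
  proof -
    have "u s < v (x + s *\<^sub>R axis k 1 + (t - s) *\<^sub>R axis k 1)"
      unfolding u_def using that slope_pos by (intro cone_strictly_monotone axis_in_cone) (auto simp: axis_def)
    then show ?thesis by (simp add: u_def algebra_simps)
  qed
  obtain t1 where "u t1 = max l (1 - b)"
    using level_attained[of "max l (1 - b)" x] l b by (auto simp: u_def)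
  then have t1: "l \<le> u t1" by simp
  obtain t0 where t0: "u t0 < l"
  proof (rule ccontr)
    assume "\<not> thesis"
    with that have "l \<le> u t" for t by (meson not_less)
    moreover obtain H where H: "0 \<le> H"
      "\<And>x h. l \<le> v x \<Longrightarrow> h \<in> cone k (slope / 2) \<Longrightarrow> H \<le> h $ k \<Longrightarrow> 1 - b / 2 \<le> v (x + h)"
      using uniform_lift[OF l(1)] by blast
    ultimately have "1 - b / 2 \<le> v (x + (t - H) *\<^sub>R axis k 1 + H *\<^sub>R axis k 1)" for t
      using slope_pos by (intro H(2) axis_in_cone) (auto simp: u_def)
    then have "1 - b / 2 \<le> u t" for t by (simp add: u_def algebra_simps)
    moreover obtain t where "u t = 1 - b" using level_attained[of "1 - b" x] b by (auto simp: u_def)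
    ultimately show False using b by (smt (verit) field_sum_of_halves)
  qed
  have "t0 \<le> t1" using strict[of t1 t0] t0 t1 by fastforce
  then obtain t where "u t = l"
    using IVT'[of u t0 l t1] t0 t1 line_cont unfolding u_def by fastforce
  moreover have "s = t" if "u s = u t" for s t
    using strict[of s t] strict[of t s] that by (metis less_irrefl linorder_neqE_linordered_idom)
  ultimately show ?thesis unfolding u_def by metis
qed

text \<open>Two points of a level set never differ by a nonzero element of the smaller cone, so the graph has slope at most
  the reciprocal of that cone's.\<close>

theorem level_set_is_lipschitz_graph:
  assumes l: "0 < l" "l < 1"
  shows "\<exists>h M. M-lipschitz_on (hyperplane k) h \<and> {x. v x = l} = {x. x $ k = h (horiz k x)}"
proof -
  define h where "h y = (THE t. v (y + t *\<^sub>R axis k 1) = l)" for y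
  have h: "v (y + t *\<^sub>R axis k 1) = l \<longleftrightarrow> t = h y" for y t
  proof -
    have "v (y + h y *\<^sub>R axis k 1) = l"
      unfolding h_def by (rule theI'[OF line_crosses_once[OF l]])
    then show ?thesis using line_crosses_once[OF l, of y] by blast
  qed
  have "v x = l \<longleftrightarrow> x $ k = h (horiz k x)" for x
    using h[of "horiz k x" "x $ k"] by (simp add: horiz_decomposition)
  moreover have steep: "h y - h y' \<le> 2 / slope * dist y y'" if "y \<in> hyperplane k" "y' \<in> hyperplane k" for y y'
  proof (rule ccontr)
    assume "\<not> ?thesis"
    then have less: "2 / slope * dist y y' < h y - h y'" by simp
    define g where "g = (y - y') + (h y - h y') *\<^sub>R axis k 1"
    have gk: "g $ k = h y - h y'" using that by (simp add: g_def hyperplane_def axis_def)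
    have "0 \<le> 2 / slope * dist y y'" using slope_pos by simp
    then have "0 < g $ k" using less gk by simp
    moreover have "g \<in> cone k (slope / 2)"
    proof -
      have "norm (horiz k g) \<le> dist y y'"
        using norm_horiz_le[of k "y - y'"] by (simp add: g_def dist_norm)
      moreover have "dist y y' \<le> slope / 2 * g $ k" using less slope_pos by (simp add: gk field_simps)
      ultimately show ?thesis by (simp add: cone_def)
    qed
    ultimately have "v (y' + h y' *\<^sub>R axis k 1) < v (y' + h y' *\<^sub>R axis k 1 + g)"
      by (intro cone_strictly_monotone)
    also have "y' + h y' *\<^sub>R axis k 1 + g = y + h y *\<^sub>R axis k 1" by (simp add: g_def algebra_simps)
    finally show False using h[of y "h y"] h[of y' "h y'"] by simp
  qed
  have "(2 / slope)-lipschitz_on (hyperplane k) h"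
  proof (rule lipschitz_onI)
    show "dist (h y) (h y') \<le> 2 / slope * dist y y'" if "y \<in> hyperplane k" "y' \<in> hyperplane k" for y y'
      using steep[OF that] steep[OF that(2,1)] by (simp add: dist_real_def dist_commute abs_le_iff)
  qed (use slope_pos in simp)
  ultimately show ?thesis by blast
qed

end

section \<open>The reaction term near zero\<close>

text \<open>In the combustion case \<open>f\<close> vanishes near \<open>0\<close>. In the bistable case \<open>f' 0 < 0\<close>, and the Hoelder
  bound on \<open>f'\<close> keeps the derivative nonpositive on a neighbourhood.\<close>

lemma reaction_nonincreasing_near_zero:
  assumes "F1 f" "F4 f"
  obtains \<delta> where "0 < \<delta>" "\<And>s t. 0 \<le> s \<Longrightarrow> s \<le> t \<Longrightarrow> t \<le> \<delta> \<Longrightarrow> f t \<le> f s"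
proof -
  obtain \<theta> where \<theta>: "0 < \<theta>" "\<theta> < 1"
    and cases: "(\<exists>d<0. (f has_real_derivative d) (at 0 within {0..1})) \<or> (\<forall>u\<in>{0<..<\<theta>}. f u = 0)"
    using assms(2) unfolding F4_def by blast
  from cases show thesis
  proof
    assume zero: "\<forall>u\<in>{0<..<\<theta>}. f u = 0"
    have f0: "f 0 = 0" using assms(1) by (simp add: F1_def)
    have z: "f u = 0" if "0 \<le> u" "u \<le> \<theta> / 2" for u
      using zero f0 that \<theta> by (cases "u = 0") auto
    show thesis
      by (rule that[of "\<theta> / 2"]) (use \<theta> in \<open>auto simp: z\<close>)
  next
    assume "\<exists>d<0. (f has_real_derivative d) (at 0 within {0..1})"
    then obtain d where d: "d < 0" "(f has_real_derivative d) (at 0 within {0..1})" by blast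
    obtain \<alpha> \<gamma> where \<alpha>: "0 < \<alpha>" and \<gamma>: "0 < \<gamma>" "\<gamma> < 1"
      and hol: "C1_holder_on \<alpha> ({0..1} \<inter> ({0..<\<gamma>} \<union> {1-\<gamma><..1})) f"
      using assms(1) unfolding F1_def by blast
    define S where "S = {0..1} \<inter> ({0..<\<gamma>} \<union> {1-\<gamma><..1})"
    obtain f' C where f': "\<And>u. u \<in> S \<Longrightarrow> (f has_real_derivative f' u) (at u within S)"
      and C: "\<And>u w. u \<in> S \<Longrightarrow> w \<in> S \<Longrightarrow> \<bar>f' u - f' w\<bar> \<le> C * \<bar>u - w\<bar> powr \<alpha>"
      using hol unfolding C1_holder_on_def S_def by blast
    \<comment> \<open>on \<open>{0..\<delta>}\<close> the Hoelder bound gives \<open>\<bar>f' u - d\<bar> \<le> - d\<close>\<close>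
    define \<delta> where "\<delta> = min (\<gamma> / 2) ((- d / (\<bar>C\<bar> + 1)) powr (1 / \<alpha>))"
    have quot: "0 < - d / (\<bar>C\<bar> + 1)" using d by (intro divide_pos_pos add_nonneg_pos) auto
    then have \<delta>: "0 < \<delta>" "\<delta> < \<gamma>" using \<gamma> by (auto simp: \<delta>_def min_def)
    have sub: "{0..\<delta>} \<subseteq> S" using \<delta> \<gamma> by (auto simp: S_def)
    have "at (0::real) within {0..\<delta>} \<noteq> bot"
      using \<delta> by (simp add: at_within_Icc_at_right trivial_limit_at_right_real)
    moreover have "(f has_vector_derivative f' 0) (at 0 within {0..\<delta>})"
      using DERIV_subset[OF f' sub, of 0] subsetD[OF sub, of 0] \<delta> by (auto simp: has_real_derivative_iff_has_vector_derivative)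
    moreover have "(f has_vector_derivative d) (at 0 within {0..\<delta>})"
      using DERIV_subset[OF d(2), of "{0..\<delta>}"] \<delta> \<gamma> by (auto simp: has_real_derivative_iff_has_vector_derivative)
    ultimately have f'0: "f' 0 = d" by (rule vector_derivative_unique_within)
    have neg: "f' u \<le> 0" if u: "0 \<le> u" "u \<le> \<delta>" for u
    proof -
      have "u powr \<alpha> \<le> ((- d / (\<bar>C\<bar> + 1)) powr (1 / \<alpha>)) powr \<alpha>"
        using u \<alpha> by (intro powr_mono2) (auto simp: \<delta>_def)
      also have "\<dots> = - d / (\<bar>C\<bar> + 1)" using \<alpha> d by (simp add: powr_powr)
      finally have "\<bar>C\<bar> * u powr \<alpha> \<le> \<bar>C\<bar> * (- d / (\<bar>C\<bar> + 1))" by (intro mult_left_mono) auto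
      also have "\<dots> \<le> - d"
        using mult_right_mono[of "\<bar>C\<bar>" "\<bar>C\<bar> + 1" "- d / (\<bar>C\<bar> + 1)"] quot by simp
      finally have "\<bar>C\<bar> * u powr \<alpha> \<le> - d" .
      moreover have "\<bar>f' u - f' 0\<bar> \<le> C * u powr \<alpha>"
        using C[of u 0] sub u \<delta> by (auto simp: subset_iff)
      moreover have "C * u powr \<alpha> \<le> \<bar>C\<bar> * u powr \<alpha>" by (intro mult_right_mono) auto
      ultimately show ?thesis using f'0 by linarith
    qed
    show thesis
    proof (rule that[OF \<delta>(1)])
      fix s t :: real assume st: "0 \<le> s" "s \<le> t" "t \<le> \<delta>"
      show "f t \<le> f s"
      proof (cases "s = t")
        case False
        then have "s < t" using st by simp
        moreover have "(f has_derivative (*) (f' x)) (at x within {s..t})" if "s \<le> x" "x \<le> t" for x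
          using DERIV_subset[OF f', of x "{s..t}"] sub that st
          by (auto simp: has_field_derivative_def subset_iff)
        ultimately obtain x where x: "x \<in> {s<..<t}" "f t - f s = f' x * (t - s)"
          using mvt_simple[of s t f "\<lambda>x. (*) (f' x)"] by auto
        then have "f' x * (t - s) \<le> 0" using neg[of x] st by (intro mult_nonpos_nonneg) auto
        then show ?thesis using x by simp
      qed simp
    qed
  qed
qed

section \<open>The wave as an entire solution\<close>

lemma partial_translate:
  fixes u :: "real^'n \<Rightarrow> real"
  assumes "\<And>x. u differentiable (at x)"
  shows "partial i (\<lambda>y. u (y + a)) x = partial i u (x + a)"
proof -
  have "(u has_derivative frechet_derivative u (at (x + a))) (at (x + a))"
    using assms frechet_derivative_works by blast
  moreover have "((\<lambda>y. y + a) has_derivative (\<lambda>h. h)) (at x)"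
    by (auto intro!: derivative_eq_intros)
  ultimately have "((\<lambda>y. u (y + a)) has_derivative frechet_derivative u (at (x + a))) (at x)"
    by (rule has_derivative_compose[rotated])
  from frechet_derivative_at[OF this] show ?thesis by (simp add: partial_def)
qed

lemma differentiable_translate:
  fixes u :: "real^'n \<Rightarrow> real"
  assumes "\<And>x. u differentiable (at x)"
  shows "(\<lambda>y. u (y + a)) differentiable (at x)"
  using differentiable_chain_at[of "\<lambda>y. y + a" x u] assms
  by (auto simp: o_def)

lemma travelling_wave_is_entire_solution:
  fixes v :: "real^'n \<Rightarrow> real" and k :: 'n
  assumes C2: "C2 v" and range: "\<And>x. 0 < v x \<and> v x < 1"
    and pde: "\<And>x. - laplacian v x + \<kappa> * partial k v x = f (v x)"
    and sup: "(SUP x. v x) = 1"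
  defines "w \<equiv> \<lambda>x t. v (x + (\<kappa> * t) *\<^sub>R axis k 1)"
  shows "entire_solution f w"
    and "dt w x t = \<kappa> * partial k v (x + (\<kappa> * t) *\<^sub>R axis k 1)"
    and "grad (\<lambda>y. w y t) x = grad v (x + (\<kappa> * t) *\<^sub>R axis k 1)"
proof -
  have d1: "v differentiable (at x)" and d2: "partial i v differentiable (at x)"
    and c2: "continuous_on UNIV (partial j (partial i v))" for i j x
    using C2 by (auto simp: C2_def)
  have p1: "partial i (\<lambda>y. w y t) = (\<lambda>x. partial i v (x + (\<kappa> * t) *\<^sub>R axis k 1))" for i t
    unfolding w_def by (rule ext) (rule partial_translate[OF d1])
  have p2: "partial j (partial i (\<lambda>y. w y t)) = (\<lambda>x. partial j (partial i v) (x + (\<kappa> * t) *\<^sub>R axis k 1))" for i j t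
    unfolding p1 by (rule ext) (rule partial_translate[OF d2])
  have wt: "(w x has_real_derivative \<kappa> * partial k v (x + (\<kappa> * t) *\<^sub>R axis k 1)) (at t)" for x t
    using derivative_along_line[of v x "\<kappa> *\<^sub>R axis k 1" t] d1
    by (simp add: w_def inner_grad_axis mult.commute)
  have dt: "dt w x t = \<kappa> * partial k v (x + (\<kappa> * t) *\<^sub>R axis k 1)" for x t
    unfolding dt_def by (rule DERIV_imp_deriv[OF wt])
  then show "dt w x t = \<kappa> * partial k v (x + (\<kappa> * t) *\<^sub>R axis k 1)" .
  show "grad (\<lambda>y. w y t) x = grad v (x + (\<kappa> * t) *\<^sub>R axis k 1)"
    by (simp add: grad_def p1)
  have joint: "continuous_on UNIV (\<lambda>(x, t). g (x + (\<kappa> * t) *\<^sub>R axis k 1))"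
    if "continuous_on UNIV g" for g :: "real^'n \<Rightarrow> real"
    unfolding case_prod_unfold
    by (rule continuous_on_compose2[OF that]) (auto intro!: continuous_intros)
  have c0: "continuous_on UNIV v" and c1: "continuous_on UNIV (partial i v)" for i
    using d1 d2 by (simp_all add: continuous_at_imp_continuous_on differentiable_imp_continuous_within)
  have "C2 (\<lambda>x. w x t)" for t
    unfolding C2_def p2 unfolding p1 unfolding w_def
    by (intro conjI allI differentiable_translate d1 d2 continuous_on_compose2[OF c2])
      (auto intro!: continuous_intros)
  moreover have "w x differentiable (at t)" for x t
    using wt real_differentiable_def by blast
  moreover have "continuous_on UNIV (\<lambda>(x, t). w x t)"
    unfolding w_def by (rule joint[OF c0])
  moreover have "continuous_on UNIV (\<lambda>(x, t). dt w x t)"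
    unfolding dt using joint[OF continuous_on_mult_left[OF c1]] by simp
  moreover have "continuous_on UNIV (\<lambda>(x, t). partial i (\<lambda>y. w y t) x)" for i
    unfolding p1 by (rule joint[OF c1])
  moreover have "continuous_on UNIV (\<lambda>(x, t). partial j (partial i (\<lambda>y. w y t)) x)" for i j
    unfolding p2 by (rule joint[OF c2])
  ultimately have "C21 w" by (simp add: C21_def)
  moreover have "dt w x t - laplacian (\<lambda>y. w y t) x = f (w x t)" for x t
    unfolding dt laplacian_def p2 using pde[of "x + (\<kappa> * t) *\<^sub>R axis k 1"] by (simp add: laplacian_def w_def)
  moreover have "(SUP x. w x t) = 1" for t
  proof -
    have "range (\<lambda>x. w x t) = v ` range (\<lambda>x. x + (\<kappa> * t) *\<^sub>R axis k 1)"
      by (simp only: w_def image_image)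
    then have "range (\<lambda>x. w x t) = range v" by (simp only: surj_plus_right)
    then show ?thesis using sup by simp
  qed
  ultimately show "entire_solution f w"
    using range by (simp add: entire_solution_def w_def)
qed


section \<open>Level sets of the wave\<close>

theorem theorem1p4:
  fixes f :: "real \<Rightarrow> real" and \<kappa> b0 :: real
    and v :: "real^'n \<Rightarrow> real" and k :: 'n
  assumes "F1 f" and "F2 f" and "F3 f" and "F4 f"
    and "is_b0 TYPE('n) f b0"
    and "\<kappa> > 0"
    and "C2 v" and "\<And>x. 0 < v x \<and> v x < 1"
    and "\<And>x. - laplacian v x + \<kappa> * partial k v x = f (v x)"
    and "(SUP x. v x) = 1"
    and "vanishes_away_from {y. v y \<ge> 1 - b0} v"
  shows "\<forall>l\<in>{0<..<1}. \<exists>h L. L-lipschitz_on (hyperplane k) h \<and>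
           {x. v x = l} = {x. x $ k = h (horiz k x)}"
proof -
  note wave = travelling_wave_is_entire_solution[of v \<kappa> k f, OF assms(7) assms(8) assms(9) assms(10)]
  define w where "w x t = v (x + (\<kappa> * t) *\<^sub>R axis k 1)" for x t
  have ent: "entire_solution f w" and dt: "dt w x 0 = \<kappa> * partial k v x"
    and gr: "grad (\<lambda>y. w y 0) x = grad v x" for x
    unfolding w_def using wave(1) wave(2,3)[where x = x and t = 0] by simp_all
  have b0: "0 < b0" "b0 < 1" using assms(5) by (simp_all add: is_b0_def)
  obtain c0 C0 where c0: "0 < c0" and C0: "0 < C0" and all: "\<forall>w :: real^'n \<Rightarrow> real \<Rightarrow> real. entire_solution f w \<longrightarrow>
        (\<forall>l\<in>{1-b0..<1}. \<exists>h L. L-lipschitz_on UNIV h \<and> {(x, t). w x t = l} = {(x, t). t = h x}) \<and>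
        (\<forall>x t. w x t > 1 - b0 \<longrightarrow> dt w x t \<ge> c0 * (1 - w x t) \<and>
            norm (grad (\<lambda>y. w y t) x) + \<bar>dt w x t\<bar> \<le> C0 * (1 - w x t))"
    using assms(5) unfolding is_b0_def by (elim conjE exE bexE) metis
  note props = mp[OF spec[OF all, of w] ent]
  obtain L where L: "L-lipschitz_on {0..1} f" and f0: "f 0 = 0"
    using assms(1) unfolding F1_def by blast
  obtain \<delta>' where \<delta>': "0 < \<delta>'" "\<And>s t. 0 \<le> s \<Longrightarrow> s \<le> t \<Longrightarrow> t \<le> \<delta>' \<Longrightarrow> f t \<le> f s"
    using reaction_nonincreasing_near_zero[OF assms(1,4)] by blast
  define \<delta> where "\<delta> = min \<delta>' ((1 - b0) / 2)"
  interpret front f L \<delta> \<kappa> b0 "c0 / \<kappa>" C0 v k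
  proof
    show "\<bar>f s - f t\<bar> \<le> L * \<bar>s - t\<bar>" if "s \<in> {0..1}" "t \<in> {0..1}" for s t
      using lipschitz_onD[OF L that] by (simp add: dist_real_def)
    show "0 < \<delta>" "\<delta> < 1 - b0" using \<delta>'(1) b0 by (auto simp: \<delta>_def min_def)
    show "f t \<le> f s" if "0 \<le> s" "s \<le> t" "t \<le> \<delta>" for s t
      using \<delta>'(2)[OF that(1,2)] that(3) by (simp add: \<delta>_def)
    show "\<exists>!t. v (x + t *\<^sub>R axis k 1) = l" if l: "1 - b0 \<le> l" "l < 1" for l x
    proof -
      obtain h where "{(x, t). w x t = l} = {(x, t). t = h x}" using bspec[OF conjunct1[OF props], of l] l by auto
      then have h: "w x t = l \<longleftrightarrow> t = h x" for t by (auto simp: set_eq_iff)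
      have "v (x + t *\<^sub>R axis k 1) = l \<longleftrightarrow> t = \<kappa> * h x" for t
        using h[of "t / \<kappa>"] assms(6) by (simp add: w_def field_simps)
      then show ?thesis by simp
    qed
    fix x assume x: "1 - b0 < v x"
    have w0: "w x 0 = v x" by (simp add: w_def)
    have e: "c0 * (1 - v x) \<le> \<kappa> * partial k v x"
      "norm (grad v x) + \<bar>\<kappa> * partial k v x\<bar> \<le> C0 * (1 - v x)"
      using conjunct2[OF props, rule_format, of x 0] x unfolding w0 dt gr by auto
    show "c0 / \<kappa> * (1 - v x) \<le> partial k v x" using e(1) assms(6) by (simp add: field_simps)
    show "norm (grad v x) \<le> C0 * (1 - v x)" using e(2) by linarith
  qed (use assms b0 c0 C0 f0 lipschitz_on_nonneg[OF L] in auto)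
  show ?thesis using level_set_is_lipschitz_graph by auto
qed

end
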